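(* In the SSS scheme with equiprobable rectangular $M_I\times M_Q$ QAM, transmit powers $P_0,P_1>0$, and fading coefficient $h\neq0$ known at the receiver, the symbol error probability given $h$ of the optimal (maximum a posteriori) detector is $$\begin{aligned}\mathrm{SEP}(P,h)=\sum_{k=0}^{1}\Pr\{\hat{\mathcal H}_k\}\Bigg\{&\Pr\{\mathcal H_0|\hat{\mathcal H}_k\}\Big[2\big(2-\tfrac1{M_I}-\tfrac1{M_Q}\big)Q(a_{0,k})-4\big(1-\tfrac1{M_I}\big)\big(1-\tfrac1{M_Q}\big)Q^2(a_{0,k})\Big]\\ +&\Pr\{\mathcal H_1|\hat{\mathcal H}_k\}\Big[2\big(2-\tfrac1{M_I}-\tfrac1{M_Q}\big)\sum_{l=1}^p\lambda_lQ(a_{1,k,l})-4\big(1-\tfrac1{M_I}\big)\big(1-\tfrac1{M_Q}\big)\sum_{l=1}^p\lambda_lQ^2(a_{1,k,l})\Big]\Bigg\},\end{aligned}$$ where $$a_{0,k}=\sqrt{\frac{d_{min,k}^2|h|^2}{4\sigma_n^2}},\qquad a_{1,k,l}=\sqrt{\frac{d_{min,k}^2|h|^2}{4(\sigma_l^2+\sigma_n^2)}},\qquad Q(x)=\int_x^\infty\frac{1}{\sqrt{2\pi}}e^{-t^2/2}\,dt .$$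
   Context: Setting (cognitive radio with imperfect sensing). The true channel state is $\mathcal H_0$ (primary user idle) or $\mathcal H_1$ (primary user active), with given prior probabilities. The sensing decision is $\hat{\mathcal H}_0$ (idle) or $\hat{\mathcal H}_1$ (busy), with $P_{\rm d}=\Pr\{\hat{\mathcal H}_1|\mathcal H_1\}$ and $P_{\rm f}=\Pr\{\hat{\mathcal H}_1|\mathcal H_0\}$. The quantities $\Pr\{\hat{\mathcal H}_k\}$ and $\Pr\{\mathcal H_j|\hat{\mathcal H}_k\}$ follow by total probability and Bayes' rule; assume $\Pr\{\hat{\mathcal H}_k\}>0$ for both $k$. In the sensing-based spectrum sharing (SSS) scheme the secondary user transmits with power $P_k$ under decision $\hat{\mathcal H}_k$, $k=0,1$. Constellation. $M_I,M_Q\ge1$ are integers with $M=M_IM_Q\ge 2$. Under $\hat{\mathcal H}_k$ the transmitted symbol is uniform on the points $s_{n,q}=s_n+js_q$ with $$s_n=(2n+1-M_I)\tfrac{d_{min,k}}{2}\ (0\le n\le M_I-1),\qquad s_q=(2q+1-M_Q)\tfrac{d_{min,k}}{2}\ (0\le q\le M_Q-1),$$ $$d_{min,k}=\sqrt{\tfrac{12P_k}{M_I^2+M_Q^2-2}}.$$ Channel. The received signal is $y=hs+n$ under $\mathcal H_0$ and $y=hs+n+w$ under $\mathcal H_1$. The noise $n$ has density $\frac{1}{2\pi\sigma_n^2}e^{-|n|^2/(2\sigma_n^2)}$ on $\mathbb C$ ($\sigma_n^2>0$). The primary interference $w$ has Gaussian mixture density $\sum_{l=1}^p\frac{\lambda_l}{2\pi\sigma_l^2}e^{-|w|^2/(2\sigma_l^2)}$,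 with $\sigma_l^2>0$, $\lambda_l\ge0$, $\sum_l\lambda_l=1$. The variables $n$ and $w$ are independent of each other. Given the sensing decision and the true state, they are also independent of the transmitted symbol. The fading $h$ is independent of the channel state, sensing decision, noise and interference. Detector. Knowing $\hat{\mathcal H}_k$, $h$ and $y$, the receiver outputs a constellation point maximizing $\Pr\{\mathcal H_0|\hat{\mathcal H}_k\}f(y|s,h,\hat{\mathcal H}_k,\mathcal H_0)+\Pr\{\mathcal H_1|\hat{\mathcal H}_k\}f(y|s,h,\hat{\mathcal H}_k,\mathcal H_1)$, where $f(y|s,h,\hat{\mathcal H}_k,\mathcal H_j)$ is the conditional density of $y$. $\mathrm{SEP}(P,h)$ is the probability, given $h$, that the output differs from the transmitted symbol, averaged over symbol, sensing decision and true state. *)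

theory Defs
  imports "HOL-Probability.Probability"
begin

definition Q_fun :: "real \<Rightarrow> real" where
  "Q_fun x = (LBINT t:{x..}. 1 / sqrt (2 * pi) * exp (- t\<^sup>2 / 2))"

definition d_min :: "nat \<Rightarrow> nat \<Rightarrow> real \<Rightarrow> real" where
  "d_min M_I M_Q P = sqrt (12 * P / ((real M_I)\<^sup>2 + (real M_Q)\<^sup>2 - 2))"

definition qam_points :: "nat \<Rightarrow> nat \<Rightarrow> real \<Rightarrow> complex set" where
  "qam_points M_I M_Q P =
    {Complex ((2 * real n + 1 - real M_I) * (d_min M_I M_Q P / 2))
             ((2 * real q + 1 - real M_Q) * (d_min M_I M_Q P / 2)) | n q. n < M_I \<and> q < M_Q}"

(* The variance per real dimension is \<sigma>^2. *)
definition gauss_density :: "real \<Rightarrow> complex \<Rightarrow> real" where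
  "gauss_density \<sigma> z = 1 / (2 * pi * \<sigma>\<^sup>2) * exp (- (cmod z)\<^sup>2 / (2 * \<sigma>\<^sup>2))"

definition mixture_density :: "nat \<Rightarrow> (nat \<Rightarrow> real) \<Rightarrow> (nat \<Rightarrow> real) \<Rightarrow> complex \<Rightarrow> real" where
  "mixture_density p lam \<sigma> z = (\<Sum>l=1..p. lam l * gauss_density (\<sigma> l) z)"

(* H is the true state and D the sensing decision (0 idle, 1 busy), S the transmitted symbol,
   N the noise, W the primary interference (it enters the received signal only when H = 1),
   G the fading, P k the transmit power under decision k.
   The joint law of (H, D) is arbitrary: the prior, P_d and P_f are
   P(H = j), P(D = 1 | H = 1) and P(D = 1 | H = 0). *)
locale sss_system = prob_space M for M :: "'a measure" +
  fixes M_I M_Q :: nat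
    and P :: "nat \<Rightarrow> real"
    and \<sigma>\<^sub>n :: real
    and p :: nat and lam :: "nat \<Rightarrow> real" and \<sigma> :: "nat \<Rightarrow> real"
    and H D :: "'a \<Rightarrow> nat"
    and S N W G :: "'a \<Rightarrow> complex"
  assumes qam_size: "1 \<le> M_I" "1 \<le> M_Q" "2 \<le> M_I * M_Q"
    and noise_variance: "0 < \<sigma>\<^sub>n\<^sup>2"
    and mixture_variance: "\<And>l. l \<in> {1..p} \<Longrightarrow> 0 < (\<sigma> l)\<^sup>2"
    and mixture_weights: "\<And>l. l \<in> {1..p} \<Longrightarrow> 0 \<le> lam l" "(\<Sum>l=1..p. lam l) = 1"
    and random_variables [measurable]:
      "H \<in> measurable M (count_space {0, 1})" "D \<in> measurable M (count_space {0, 1})"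
      "S \<in> borel_measurable M" "N \<in> borel_measurable M" "W \<in> borel_measurable M"
      "G \<in> borel_measurable M"
    and decision_pos: "\<And>k. k \<in> {0, 1} \<Longrightarrow> 0 < \<P>(\<omega> in M. D \<omega> = k)"
    and symbol_uniform: "\<And>k j s. \<lbrakk>k \<in> {0, 1}; j \<in> {0, 1};
        0 < \<P>(\<omega> in M. D \<omega> = k \<and> H \<omega> = j); s \<in> qam_points M_I M_Q (P k)\<rbrakk> \<Longrightarrow>
      \<P>(\<omega> in M. S \<omega> = s \<bar> D \<omega> = k \<and> H \<omega> = j) = 1 / (real M_I * real M_Q)"
    and noise_density: "\<And>k j. \<lbrakk>k \<in> {0, 1}; j \<in> {0, 1};
        0 < \<P>(\<omega> in M. D \<omega> = k \<and> H \<omega> = j)\<rbrakk> \<Longrightarrow>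
      distributed (uniform_measure M {\<omega> \<in> space M. D \<omega> = k \<and> H \<omega> = j}) lborel N
        (\<lambda>z. ennreal (gauss_density \<sigma>\<^sub>n z))"
    and interference_density: "\<And>k j. \<lbrakk>k \<in> {0, 1}; j \<in> {0, 1};
        0 < \<P>(\<omega> in M. D \<omega> = k \<and> H \<omega> = j)\<rbrakk> \<Longrightarrow>
      distributed (uniform_measure M {\<omega> \<in> space M. D \<omega> = k \<and> H \<omega> = j}) lborel W
        (\<lambda>z. ennreal (mixture_density p lam \<sigma> z))"
    and symbol_noise_interference_indep: "\<And>k j. \<lbrakk>k \<in> {0, 1}; j \<in> {0, 1};
        0 < \<P>(\<omega> in M. D \<omega> = k \<and> H \<omega> = j)\<rbrakk> \<Longrightarrow>
      prob_space.indep_vars (uniform_measure M {\<omega> \<in> space M. D \<omega> = k \<and> H \<omega> = j})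
        (\<lambda>_. borel) (\<lambda>i. [S, N, W] ! i) {0, 1, 2}"
    and fading_indep:
      "indep_set
         (sets (vimage_algebra (space M) (\<lambda>\<omega>. (H \<omega>, D \<omega>, S \<omega>, N \<omega>, W \<omega>))
            (count_space {0, 1} \<Otimes>\<^sub>M count_space {0, 1} \<Otimes>\<^sub>M borel \<Otimes>\<^sub>M borel \<Otimes>\<^sub>M borel)))
         (sets (vimage_algebra (space M) G borel))"

(* The received signal when the fading equals h. Since the fading is independent of
   (H, D, S, N, W), substituting h for G is conditioning on G = h. *)
definition received :: "('a \<Rightarrow> nat) \<Rightarrow> ('a \<Rightarrow> complex) \<Rightarrow> ('a \<Rightarrow> complex) \<Rightarrow> ('a \<Rightarrow> complex)
    \<Rightarrow> complex \<Rightarrow> 'a \<Rightarrow> complex" where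
  "received H S N W h \<omega> = h * S \<omega> + N \<omega> + (if H \<omega> = 1 then W \<omega> else 0)"

(* f h k j s is a version of the density of y given s, h, decision k and state j;
   nothing is required when decision k and state j have joint probability 0. *)
definition is_conditional_density :: "'a measure \<Rightarrow> nat \<Rightarrow> nat \<Rightarrow> (nat \<Rightarrow> real) \<Rightarrow>
    ('a \<Rightarrow> nat) \<Rightarrow> ('a \<Rightarrow> nat) \<Rightarrow> ('a \<Rightarrow> complex) \<Rightarrow> (complex \<Rightarrow> 'a \<Rightarrow> complex) \<Rightarrow>
    (complex \<Rightarrow> nat \<Rightarrow> nat \<Rightarrow> complex \<Rightarrow> complex \<Rightarrow> real) \<Rightarrow> bool" where
  "is_conditional_density M M_I M_Q P H D S Y f \<longleftrightarrow>
    (\<forall>h k j s y. 0 \<le> f h k j s y) \<and>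
    (\<forall>h. \<forall>k\<in>{0, 1}. \<forall>j\<in>{0, 1}. \<forall>s\<in>qam_points M_I M_Q (P k).
      0 < \<P>(\<omega> in M. D \<omega> = k \<and> H \<omega> = j) \<longrightarrow>
      distributed (uniform_measure M {\<omega> \<in> space M. D \<omega> = k \<and> H \<omega> = j \<and> S \<omega> = s}) lborel (Y h)
        (\<lambda>y. ennreal (f h k j s y)))"

definition map_metric :: "'a measure \<Rightarrow> ('a \<Rightarrow> nat) \<Rightarrow> ('a \<Rightarrow> nat) \<Rightarrow>
    (complex \<Rightarrow> nat \<Rightarrow> nat \<Rightarrow> complex \<Rightarrow> complex \<Rightarrow> real) \<Rightarrow> nat \<Rightarrow> complex \<Rightarrow> complex \<Rightarrow> complex \<Rightarrow> real"
  where
  "map_metric M H D f k h y s =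
    \<P>(\<omega> in M. H \<omega> = 0 \<bar> D \<omega> = k) * f h k 0 s y + \<P>(\<omega> in M. H \<omega> = 1 \<bar> D \<omega> = k) * f h k 1 s y"

(* Ties may be broken in any measurable way. *)
definition is_map_detector :: "'a measure \<Rightarrow> nat \<Rightarrow> nat \<Rightarrow> (nat \<Rightarrow> real) \<Rightarrow>
    ('a \<Rightarrow> nat) \<Rightarrow> ('a \<Rightarrow> nat) \<Rightarrow> (complex \<Rightarrow> nat \<Rightarrow> nat \<Rightarrow> complex \<Rightarrow> complex \<Rightarrow> real) \<Rightarrow>
    (nat \<Rightarrow> complex \<Rightarrow> complex \<Rightarrow> complex) \<Rightarrow> bool" where
  "is_map_detector M M_I M_Q P H D f detect \<longleftrightarrow>
    (\<forall>k\<in>{0, 1}. (\<lambda>(h, y). detect k h y) \<in> borel_measurable (borel \<Otimes>\<^sub>M borel)) \<and>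
    (\<forall>k\<in>{0, 1}. \<forall>h y. detect k h y \<in> qam_points M_I M_Q (P k) \<and>
      (\<forall>s\<in>qam_points M_I M_Q (P k).
        map_metric M H D f k h y s \<le> map_metric M H D f k h y (detect k h y)))"

(* The symbol error probability given fading h;
   SEP_eq_conditional_probability below justifies the definition. *)
definition SEP :: "'a measure \<Rightarrow> ('a \<Rightarrow> nat) \<Rightarrow> ('a \<Rightarrow> complex) \<Rightarrow> (complex \<Rightarrow> 'a \<Rightarrow> complex) \<Rightarrow>
    (nat \<Rightarrow> complex \<Rightarrow> complex \<Rightarrow> complex) \<Rightarrow> complex \<Rightarrow> real" where
  "SEP M D S Y detect h = \<P>(\<omega> in M. detect (D \<omega>) h (Y h \<omega>) \<noteq> S \<omega>)"

lemma (in prob_space) real_cond_exp_indep_freeze: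
  fixes g :: "'b \<times> 'c :: topological_space \<Rightarrow> real"
  assumes ind: "indep_set (sets (vimage_algebra (space M) X T)) (sets (vimage_algebra (space M) G borel))"
    and rv [measurable]: "X \<in> measurable M T" "G \<in> borel_measurable M"
    and g [measurable]: "g \<in> borel_measurable (T \<Otimes>\<^sub>M borel)"
    and bd: "\<And>z. \<bar>g z\<bar> \<le> B"
  shows "AE \<omega> in M. real_cond_exp M (vimage_algebra (space M) G borel) (\<lambda>\<omega>. g (X \<omega>, G \<omega>)) \<omega>
           = (\<integral>\<omega>'. g (X \<omega>', G \<omega>) \<partial>M)"
proof -
  let ?F = "vimage_algebra (space M) G borel"
  have GF [measurable]: "G \<in> borel_measurable ?F"
    by (rule measurable_vimage_algebra1) auto
  have sub: "subalgebra M ?F"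
    using rv(2) unfolding subalgebra_def
    by (auto simp: sets_vimage_algebra2)
  interpret F: finite_measure_subalgebra M ?F
    by unfold_locales (rule sub)
  interpret X: prob_space "distr M T X" by (rule prob_space_distr) fact
  interpret G: prob_space "distr M borel G" by (rule prob_space_distr) fact
  interpret XG: pair_prob_space "distr M T X" "distr M borel G" ..
  have prod: "distr M T X \<Otimes>\<^sub>M distr M borel G = distr M (T \<Otimes>\<^sub>M borel) (\<lambda>x. (X x, G x))"
  proof (rule pair_measure_eqI)
    show "sigma_finite_measure (distr M T X)" "sigma_finite_measure (distr M borel G)" ..
    show "sets (distr M T X \<Otimes>\<^sub>M distr M borel G) = sets (distr M (T \<Otimes>\<^sub>M borel) (\<lambda>x. (X x, G x)))"
      by simp
    fix A B assume "A \<in> sets (distr M T X)" "B \<in> sets (distr M borel G)"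
    then have AB [measurable]: "A \<in> sets T" "B \<in> sets borel" by auto
    let ?A = "X -` A \<inter> space M" and ?B = "G -` B \<inter> space M"
    have "?A \<in> sets (vimage_algebra (space M) X T)" "?B \<in> sets (vimage_algebra (space M) G borel)"
      using AB by (auto intro: in_vimage_algebra)
    from indep_setD[OF ind this] have "prob (?A \<inter> ?B) = prob ?A * prob ?B" .
    moreover have "?A \<inter> ?B = (\<lambda>x. (X x, G x)) -` (A \<times> B) \<inter> space M" by auto
    ultimately show "emeasure (distr M T X) A * emeasure (distr M borel G) B
        = emeasure (distr M (T \<Otimes>\<^sub>M borel) (\<lambda>x. (X x, G x))) (A \<times> B)"
      by (simp add: emeasure_distr emeasure_eq_measure ennreal_mult'')
  qed
  define c where "c = (\<lambda>h. \<integral>x. g (x, h) \<partial>distr M T X)"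
  have c_eq: "c h = (\<integral>\<omega>'. g (X \<omega>', h) \<partial>M)" for h
    unfolding c_def by (subst integral_distr) auto
  have c_meas [measurable]: "c \<in> borel_measurable borel"
  proof -
    have "(\<lambda>(h, x). g (x, h)) \<in> borel_measurable (borel \<Otimes>\<^sub>M distr M T X)"
      by measurable
    from X.borel_measurable_lebesgue_integral[OF this] show ?thesis
      unfolding c_def by simp
  qed
  have B0: "0 \<le> B" using bd[of undefined] by linarith
  have c_bd: "\<bar>c h\<bar> \<le> B" for h
  proof -
    have i: "integrable (distr M T X) (\<lambda>x. g (x, h))"
      by (rule X.integrable_const_bound[where B = B]) (use bd in auto)
    have "\<bar>c h\<bar> \<le> (\<integral>x. \<bar>g (x, h)\<bar> \<partial>distr M T X)"
      unfolding c_def by (rule integral_abs_bound)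
    also have "\<dots> \<le> B"
      by (rule X.integral_le_const) (use i bd in auto)
    finally show ?thesis .
  qed
  have "AE \<omega> in M. real_cond_exp M ?F (\<lambda>\<omega>. g (X \<omega>, G \<omega>)) \<omega> = c (G \<omega>)"
  proof (rule F.real_cond_exp_charact)
    show "integrable M (\<lambda>\<omega>. g (X \<omega>, G \<omega>))"
      by (rule integrable_const_bound[where B = B]) (use bd in auto)
    show "integrable M (\<lambda>\<omega>. c (G \<omega>))"
      by (rule integrable_const_bound[where B = B]) (use c_bd in auto)
    show "(\<lambda>\<omega>. c (G \<omega>)) \<in> borel_measurable ?F" by measurable
    fix A assume "A \<in> sets ?F"
    then obtain U where U [measurable]: "U \<in> sets borel" and A: "A = G -` U \<inter> space M"
      by (auto simp: sets_vimage_algebra2)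
    let ?g = "\<lambda>z. indicator U (snd z) * g z"
    have gm [measurable]: "?g \<in> borel_measurable (distr M T X \<Otimes>\<^sub>M distr M borel G)" by measurable
    have int: "integrable (distr M T X \<Otimes>\<^sub>M distr M borel G) ?g"
      by (rule XG.integrable_const_bound[where B = B])
         (use bd B0 in \<open>auto simp: indicator_def\<close>)
    have "(\<integral>\<omega>\<in>A. g (X \<omega>, G \<omega>) \<partial>M) = (\<integral>\<omega>. ?g (X \<omega>, G \<omega>) \<partial>M)"
      unfolding set_lebesgue_integral_def A
      by (rule Bochner_Integration.integral_cong) (auto simp: indicator_def)
    also have "\<dots> = (\<integral>z. ?g z \<partial>distr M (T \<Otimes>\<^sub>M borel) (\<lambda>x. (X x, G x)))"
      by (subst integral_distr) auto
    also have "\<dots> = (\<integral>h. \<integral>x. ?g (x, h) \<partial>distr M T X \<partial>distr M borel G)"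
      unfolding prod[symmetric] using XG.integral_snd[of "\<lambda>x h. ?g (x, h)"] int
      by (simp add: case_prod_beta split_beta')
    also have "\<dots> = (\<integral>h. indicator U h * c h \<partial>distr M borel G)"
      unfolding c_def by simp
    also have "\<dots> = (\<integral>\<omega>. indicator U (G \<omega>) * c (G \<omega>) \<partial>M)"
      by (subst integral_distr) auto
    also have "\<dots> = (\<integral>\<omega>\<in>A. c (G \<omega>) \<partial>M)"
      unfolding set_lebesgue_integral_def A
      by (rule Bochner_Integration.integral_cong) (auto simp: indicator_def)
    finally show "(\<integral>\<omega>\<in>A. g (X \<omega>, G \<omega>) \<partial>M) = (\<integral>\<omega>\<in>A. c (G \<omega>) \<partial>M)" .
  qed
  then show ?thesis unfolding c_eq .
qed

lemma (in sss_system) SEP_eq_conditional_probability: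
  assumes detect: "\<And>k. k \<in> {0, 1} \<Longrightarrow> (\<lambda>(h, y). detect k h y) \<in> borel_measurable (borel \<Otimes>\<^sub>M borel)"
  defines "Y \<equiv> received H S N W"
  shows "AE \<omega> in M. real_cond_exp M (vimage_algebra (space M) G borel)
           (indicator {\<omega> \<in> space M. detect (D \<omega>) (G \<omega>) (Y (G \<omega>) \<omega>) \<noteq> S \<omega>}) \<omega>
         = SEP M D S Y detect (G \<omega>)"
proof -
  let ?T = "count_space {0, 1::nat} \<Otimes>\<^sub>M count_space {0, 1::nat} \<Otimes>\<^sub>M
    (borel :: complex measure) \<Otimes>\<^sub>M (borel :: complex measure) \<Otimes>\<^sub>M (borel :: complex measure)"
  let ?X = "\<lambda>\<omega>. (H \<omega>, D \<omega>, S \<omega>, N \<omega>, W \<omega>)"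
  have d0 [measurable]: "(\<lambda>z. detect 0 (fst z) (snd z)) \<in> borel_measurable (borel \<Otimes>\<^sub>M borel)"
   and d1 [measurable]: "(\<lambda>z. detect 1 (fst z) (snd z)) \<in> borel_measurable (borel \<Otimes>\<^sub>M borel)"
    using detect[of 0] detect[of 1] by (auto simp: case_prod_beta)
  define y :: "(nat \<times> nat \<times> complex \<times> complex \<times> complex) \<times> complex \<Rightarrow> complex" where
    "y = (\<lambda>z. snd z * fst (snd (snd (fst z))) + fst (snd (snd (snd (fst z))))
       + (if fst (fst z) = 1 then snd (snd (snd (snd (fst z)))) else 0))"
  have y_meas [measurable]: "y \<in> borel_measurable (?T \<Otimes>\<^sub>M borel)"
    unfolding y_def by measurable
  define out where "out = (\<lambda>z. if fst (snd (fst z)) = 0 then detect 0 (snd z) (y z) else detect 1 (snd z) (y z))"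
  have m: "(\<lambda>z. (snd z, y z)) \<in> measurable (?T \<Otimes>\<^sub>M borel) (borel \<Otimes>\<^sub>M borel)" by measurable
  have o0 [measurable]: "(\<lambda>z. detect 0 (snd z) (y z)) \<in> borel_measurable (?T \<Otimes>\<^sub>M borel)"
    using measurable_compose[OF m d0] by simp
  have o1 [measurable]: "(\<lambda>z. detect 1 (snd z) (y z)) \<in> borel_measurable (?T \<Otimes>\<^sub>M borel)"
    using measurable_compose[OF m d1] by simp
  have out_meas [measurable]: "out \<in> borel_measurable (?T \<Otimes>\<^sub>M borel)"
    unfolding out_def by measurable
  define g where "g = (\<lambda>z. if out z = fst (snd (snd (fst z))) then 0 else 1 :: real)"
  have g_meas [measurable]: "g \<in> borel_measurable (?T \<Otimes>\<^sub>M borel)"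
    unfolding g_def by measurable
  have X [measurable]: "?X \<in> measurable M ?T" by measurable
  have D01: "D \<omega> \<in> {0, 1}" if "\<omega> \<in> space M" for \<omega>
    using measurable_space[OF random_variables(2) that] by simp
  have g_eq: "g (?X \<omega>, h) = indicator {\<omega> \<in> space M. detect (D \<omega>) h (Y h \<omega>) \<noteq> S \<omega>} \<omega>"
    if "\<omega> \<in> space M" for \<omega> h
    using that D01[OF that] by (auto simp: g_def out_def y_def Y_def received_def)
  have "AE \<omega> in M. real_cond_exp M (vimage_algebra (space M) G borel) (\<lambda>\<omega>. g (?X \<omega>, G \<omega>)) \<omega>
           = (\<integral>\<omega>'. g (?X \<omega>', G \<omega>) \<partial>M)"
    by (rule real_cond_exp_indep_freeze[OF fading_indep X random_variables(6) g_meas, where B = 1])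
       (simp add: g_def)
  moreover have "(\<integral>\<omega>'. g (?X \<omega>', h) \<partial>M) = SEP M D S Y detect h" for h
  proof -
    have "{\<omega> \<in> space M. detect (D \<omega>) h (Y h \<omega>) \<noteq> S \<omega>} = {\<omega> \<in> space M. g (?X \<omega>, h) = 1}"
      using g_eq by (auto simp: indicator_def split: if_splits)
    also have "\<dots> \<in> sets M" by measurable
    finally have E: "{\<omega> \<in> space M. detect (D \<omega>) h (Y h \<omega>) \<noteq> S \<omega>} \<in> sets M" .
    have "(\<integral>\<omega>'. g (?X \<omega>', h) \<partial>M)
        = (\<integral>\<omega>'. indicator {\<omega> \<in> space M. detect (D \<omega>) h (Y h \<omega>) \<noteq> S \<omega>} \<omega>' \<partial>M)"
      by (rule Bochner_Integration.integral_cong) (auto simp only: g_eq)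
    then show ?thesis using E unfolding SEP_def by (simp add: Int_absorb2)
  qed
  moreover have "AE \<omega> in M. real_cond_exp M (vimage_algebra (space M) G borel) (\<lambda>\<omega>. g (?X \<omega>, G \<omega>)) \<omega>
     = real_cond_exp M (vimage_algebra (space M) G borel)
           (indicator {\<omega> \<in> space M. detect (D \<omega>) (G \<omega>) (Y (G \<omega>) \<omega>) \<noteq> S \<omega>}) \<omega>"
  proof -
    have sub: "subalgebra M (vimage_algebra (space M) G borel)"
      using random_variables(6) unfolding subalgebra_def by (auto simp: sets_vimage_algebra2)
    interpret F: finite_measure_subalgebra M "vimage_algebra (space M) G borel"
      by unfold_locales (rule sub)
    have e: "g (?X \<omega>, G \<omega>) = indicator {\<omega> \<in> space M. detect (D \<omega>) (G \<omega>) (Y (G \<omega>) \<omega>) \<noteq> S \<omega>} \<omega>"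
      if "\<omega> \<in> space M" for \<omega>
      using g_eq[OF that] that by (auto simp: indicator_def)
    have gm: "(\<lambda>\<omega>. g (?X \<omega>, G \<omega>)) \<in> borel_measurable M" by measurable
    have im: "(indicator {\<omega> \<in> space M. detect (D \<omega>) (G \<omega>) (Y (G \<omega>) \<omega>) \<noteq> S \<omega>} :: 'a \<Rightarrow> real)
        \<in> borel_measurable M"
      using gm e by (subst measurable_cong[where g = "\<lambda>\<omega>. g (?X \<omega>, G \<omega>)"]) auto
    show ?thesis
      by (rule F.real_cond_exp_cong[OF _ gm im]) (use e in auto)
  qed
  ultimately show ?thesis by (auto elim: AE_mp)
qed

end

(* Given decision k and state j the disturbance is a mixture of circular Gaussians, so its density
   decreases strictly in the modulus. Both densities entering the MAP metric therefore decrease in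
   the distance from y to the faded symbol, and the optimal detector is almost everywhere the
   minimum distance detector, whatever the posterior of the state. By rotation invariance the
   rotated Voronoi cells have the same Gaussian measure as axis-parallel rectangles, so the
   probability of a correct decision factors into two one-dimensional pulse amplitude problems:
   each coordinate is right with probability 1 - (number of neighbouring levels) Q(a), and
   averaging over the levels gives 1 - 2 (1 - 1/M_I) Q(a) and 1 - 2 (1 - 1/M_Q) Q(a). *)

theory Submission
  imports Defs
begin

section \<open>Rotation invariance and Gaussian densities in the complex plane\<close>

text \<open>The conditional density may be any version and ties may be broken in any measurable way,
  so the decision region of a symbol is known only up to null sets and ties. It is therefore never
  computed: almost everywhere it is squeezed between an open and a closed cell of equal Gaussian
  mass. A mixture of circular Gaussians does not in general have independent coordinates, but each
  component does. The product of the two coordinate probabilities is formed within a component and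
  averaged afterwards, which is why the formula contains the average of Q^2 and not the square of
  the average of Q. Dividing the disturbance by \<open>h\<close> moves the fading from the
  constellation to the noise. Cells become axis-parallel and a deviation t becomes t / |h|, so the
  argument of Q is half the spacing, d / 2, over t / |h|.\<close>

lemma borel_measurable_Complex [measurable (raw)]:
  assumes [measurable]: "f \<in> borel_measurable M" "g \<in> borel_measurable M"
  shows "(\<lambda>x. Complex (f x) (g x)) \<in> borel_measurable M"
  unfolding Complex_eq by measurable

text \<open>Lebesgue measure is determined by its values on boxes, and the preimage of a complex box
  is a product of two real intervals. The iterated integrals over real and imaginary part rest on
  this.\<close>

lemma lborel_complex_eq_distr_pair:
  "lborel = distr (lborel \<Otimes>\<^sub>M lborel) borel (\<lambda>(x, y). Complex x y)"
proof (rule lborel_eqI)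
  fix l u :: complex
  assume le: "\<And>b. b \<in> Basis \<Longrightarrow> l \<bullet> b \<le> u \<bullet> b"
  have le': "Re l \<le> Re u" "Im l \<le> Im u"
    using le[of 1] le[of \<i>] by (auto simp: Basis_complex_def inner_complex_def)
  have "(\<lambda>(x, y). Complex x y) -` box l u = box (Re l) (Re u) \<times> box (Im l) (Im u)"
    by (auto simp: box_def Basis_complex_def inner_complex_def)
  then have "emeasure (distr (lborel \<Otimes>\<^sub>M lborel) borel (\<lambda>(x, y). Complex x y)) (box l u)
      = emeasure (lborel \<Otimes>\<^sub>M lborel) (box (Re l) (Re u) \<times> box (Im l) (Im u))"
    by (subst emeasure_distr) (auto simp: space_pair_measure)
  also have "\<dots> = ennreal ((Re u - Re l) * (Im u - Im l))"
    using le' by (subst lborel.emeasure_pair_measure_Times) (auto simp: ennreal_mult)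
  finally show "emeasure (distr (lborel \<Otimes>\<^sub>M lborel) borel (\<lambda>(x, y). Complex x y)) (box l u)
      = ennreal (\<Prod>b\<in>Basis. (u - l) \<bullet> b)"
    by (simp add: Basis_complex_def inner_complex_def)
qed simp

lemma nn_integral_lborel_complex:
  fixes f :: "complex \<Rightarrow> ennreal"
  assumes [measurable]: "f \<in> borel_measurable borel"
  shows "(\<integral>\<^sup>+z. f z \<partial>lborel) = (\<integral>\<^sup>+x. \<integral>\<^sup>+y. f (Complex x y) \<partial>lborel \<partial>lborel)"
  by (subst lborel_complex_eq_distr_pair)
     (simp add: nn_integral_distr case_prod_beta lborel.nn_integral_fst[symmetric])

lemma nn_integral_lborel_translate:
  fixes f :: "'b::euclidean_space \<Rightarrow> ennreal"
  assumes [measurable]: "f \<in> borel_measurable borel"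
  shows "(\<integral>\<^sup>+z. f (c + z) \<partial>lborel) = (\<integral>\<^sup>+z. f z \<partial>lborel)"
  by (subst (2) lborel_distr_plus[of c, symmetric]) (simp add: nn_integral_distr)

text \<open>On each horizontal line the shear is a translation, which leaves the inner integral
  unchanged. The real part has to be integrated first, hence the two exchanges of order.\<close>

lemma nn_integral_lborel_complex_shear_Re:
  fixes f :: "complex \<Rightarrow> ennreal"
  assumes [measurable]: "f \<in> borel_measurable borel"
  shows "(\<integral>\<^sup>+z. f (Complex (Re z + t * Im z) (Im z)) \<partial>lborel) = (\<integral>\<^sup>+z. f z \<partial>lborel)"
proof -
  have "(\<integral>\<^sup>+z. f (Complex (Re z + t * Im z) (Im z)) \<partial>lborel)
      = (\<integral>\<^sup>+y. \<integral>\<^sup>+x. f (Complex (t * y + x) y) \<partial>lborel \<partial>lborel)"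
    by (subst nn_integral_lborel_complex, simp, subst lborel_pair.Fubini'[symmetric])
       (auto simp: add.commute)
  also have "\<dots> = (\<integral>\<^sup>+y. \<integral>\<^sup>+x. f (Complex x y) \<partial>lborel \<partial>lborel)"
    by (subst nn_integral_lborel_translate) auto
  also have "\<dots> = (\<integral>\<^sup>+z. f z \<partial>lborel)"
    by (subst nn_integral_lborel_complex, simp, subst lborel_pair.Fubini') auto
  finally show ?thesis .
qed

lemma nn_integral_lborel_complex_shear_Im:
  fixes f :: "complex \<Rightarrow> ennreal"
  assumes [measurable]: "f \<in> borel_measurable borel"
  shows "(\<integral>\<^sup>+z. f (Complex (Re z) (Im z + t * Re z)) \<partial>lborel) = (\<integral>\<^sup>+z. f z \<partial>lborel)"
proof -
  have "(\<integral>\<^sup>+z. f (Complex (Re z) (Im z + t * Re z)) \<partial>lborel)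
      = (\<integral>\<^sup>+x. \<integral>\<^sup>+y. f (Complex x (t * x + y)) \<partial>lborel \<partial>lborel)"
    by (subst nn_integral_lborel_complex) (auto simp: add.commute)
  also have "\<dots> = (\<integral>\<^sup>+x. \<integral>\<^sup>+y. f (Complex x y) \<partial>lborel \<partial>lborel)"
    by (subst nn_integral_lborel_translate) auto
  also have "\<dots> = (\<integral>\<^sup>+z. f z \<partial>lborel)"
    by (subst nn_integral_lborel_complex) auto
  finally show ?thesis .
qed

(* A plane rotation by an angle that is not a multiple of pi is a product of three shears. *)
lemma nn_integral_lborel_rotate_nonreal:
  fixes f :: "complex \<Rightarrow> ennreal"
  assumes f [measurable]: "f \<in> borel_measurable borel" and c: "cmod c = 1" "Im c \<noteq> 0"
  shows "(\<integral>\<^sup>+z. f (c * z) \<partial>lborel) = (\<integral>\<^sup>+z. f z \<partial>lborel)"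
proof -
  \<comment> \<open>For c = exp (i theta) this is - tan (theta / 2), the parameter of the two outer
    shears; the middle one has parameter sin theta.\<close>
  define t where "t = (Re c - 1) / Im c"
  let ?A = "\<lambda>z. Complex (Re z + t * Im z) (Im z)"
  let ?B = "\<lambda>z. Complex (Re z) (Im z + Im c * Re z)"
  have unit: "(Re c)\<^sup>2 + (Im c)\<^sup>2 = 1"
    using c(1) by (simp add: cmod_def)
  have t: "t * Im c = Re c - 1"
    using c(2) by (simp add: t_def)
  have t2: "t * (Re c + 1) = - Im c"
    using c(2) unit unfolding t_def by (simp add: field_simps power2_eq_square)
  have "c * z = ?A (?B (?A z))" for z
  proof (rule complex_eqI)
    have "Re (?A (?B (?A z))) = (1 + t * Im c) * Re z + (t * (Re c + 1)) * Im z
        + t * Im z * (1 + t * Im c - Re c)"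
      by (simp add: algebra_simps)
    then show "Re (c * z) = Re (?A (?B (?A z)))"
      by (simp add: t t2)
    have "Im (?A (?B (?A z))) = (1 + t * Im c) * Im z + Im c * Re z"
      by (simp add: algebra_simps)
    then show "Im (c * z) = Im (?A (?B (?A z)))"
      by (simp add: t)
  qed
  then have "(\<integral>\<^sup>+z. f (c * z) \<partial>lborel) = (\<integral>\<^sup>+z. f (?A (?B (?A z))) \<partial>lborel)"
    by simp
  also have "\<dots> = (\<integral>\<^sup>+z. f (?A (?B z)) \<partial>lborel)"
    by (rule nn_integral_lborel_complex_shear_Re[of "\<lambda>z. f (?A (?B z))"]) measurable
  also have "\<dots> = (\<integral>\<^sup>+z. f (?A z) \<partial>lborel)"
    by (rule nn_integral_lborel_complex_shear_Im[of "\<lambda>z. f (?A z)"]) measurable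
  also have "\<dots> = (\<integral>\<^sup>+z. f z \<partial>lborel)"
    by (rule nn_integral_lborel_complex_shear_Re) measurable
  finally show ?thesis .
qed

lemma nn_integral_lborel_rotate:
  fixes f :: "complex \<Rightarrow> ennreal"
  assumes f [measurable]: "f \<in> borel_measurable borel" and c: "cmod c = 1"
  shows "(\<integral>\<^sup>+z. f (c * z) \<partial>lborel) = (\<integral>\<^sup>+z. f z \<partial>lborel)"
proof (cases "Im c = 0")
  case True
  \<comment> \<open>For c = 1 or c = -1 the shear parameter is undefined. Instead c is the product
    of \<open>- (c * \<i>)\<close> and \<open>\<i>\<close>, both off the real axis.\<close>
  have "Re c \<noteq> 0"
    using c True by (auto simp: cmod_def)
  then have "(\<integral>\<^sup>+z. f ((- (c * \<i>)) * z) \<partial>lborel) = (\<integral>\<^sup>+z. f z \<partial>lborel)"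
    using c by (intro nn_integral_lborel_rotate_nonreal) (auto simp: norm_mult)
  moreover have "(\<integral>\<^sup>+z. f ((- (c * \<i>)) * (\<i> * z)) \<partial>lborel) = (\<integral>\<^sup>+z. f ((- (c * \<i>)) * z) \<partial>lborel)"
    by (intro nn_integral_lborel_rotate_nonreal[of "\<lambda>z. f ((- (c * \<i>)) * z)"]) auto
  moreover have "(- (c * \<i>)) * (\<i> * z) = c * z" for z
    by (simp add: algebra_simps)
  ultimately show ?thesis by simp
qed (use c in \<open>auto intro: nn_integral_lborel_rotate_nonreal\<close>)

text \<open>Polar decomposition: the rotation by \<open>sgn c\<close> preserves the integral, and
  the dilation by \<open>cmod c\<close> contributes the planar Jacobian.\<close>

lemma nn_integral_lborel_complex_mult:
  fixes f :: "complex \<Rightarrow> ennreal"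
  assumes f [measurable]: "f \<in> borel_measurable borel" and c: "c \<noteq> 0"
  shows "(\<integral>\<^sup>+z. f z \<partial>lborel) = ennreal ((cmod c)\<^sup>2) * (\<integral>\<^sup>+z. f (c * z) \<partial>lborel)"
proof -
  have "(\<integral>\<^sup>+z. f z \<partial>lborel) = (\<integral>\<^sup>+z. f (sgn c * z) \<partial>lborel)"
    using c by (simp add: nn_integral_lborel_rotate norm_sgn)
  also have "\<dots> = ennreal ((cmod c)\<^sup>2) * (\<integral>\<^sup>+z. f (sgn c * (cmod c *\<^sub>R z)) \<partial>lborel)"
    using c
    by (subst lborel_affine[of "cmod c" 0])
       (auto simp: nn_integral_density nn_integral_distr nn_integral_cmult)
  also have "(\<lambda>z. f (sgn c * (cmod c *\<^sub>R z))) = (\<lambda>z. f (c * z))"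
    using c by (simp add: sgn_div_norm)
  finally show ?thesis .
qed

section \<open>Circular Gaussian densities and their coordinates\<close>

lemma gauss_density_eq_normal:
  "\<tau> \<noteq> 0 \<Longrightarrow> gauss_density \<tau> z = normal_density 0 \<tau> (Re z) * normal_density 0 \<tau> (Im z)"
  by (simp add: gauss_density_def normal_density_def cmod_def mult_exp_exp add_divide_distrib
      diff_divide_distrib)

lemma gauss_density_nonneg [simp]: "0 \<le> gauss_density \<tau> z"
  by (simp add: gauss_density_def)

text \<open>Only squares of deviations are assumed positive, so a deviation may be negative. This
  passes to a positive one, as facts about normal laws require.\<close>

lemma gauss_density_abs [simp]: "gauss_density \<bar>\<tau>\<bar> z = gauss_density \<tau> z"
  by (simp add: gauss_density_def)

lemma borel_measurable_gauss_density [measurable]: "gauss_density \<tau> \<in> borel_measurable borel"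
  unfolding gauss_density_def by measurable

lemma gauss_density_strict_antimono:
  "\<tau> \<noteq> 0 \<Longrightarrow> cmod z < cmod w \<Longrightarrow> gauss_density \<tau> w < gauss_density \<tau> z"
  by (simp add: gauss_density_def divide_strict_right_mono power_strict_mono)

lemma nn_integral_complex_product:
  fixes f g :: "real \<Rightarrow> ennreal"
  assumes [measurable]: "f \<in> borel_measurable borel" "g \<in> borel_measurable borel"
  shows "(\<integral>\<^sup>+z. f (Re z) * g (Im z) \<partial>lborel) = (\<integral>\<^sup>+x. f x \<partial>lborel) * (\<integral>\<^sup>+x. g x \<partial>lborel)"
  by (simp add: nn_integral_lborel_complex nn_integral_cmult nn_integral_multc)

text \<open>Both factors split over the coordinates, so the planar convolution is a product of two
  real ones, in each of which the variances add.\<close>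

lemma conv_gauss_density:
  assumes "\<sigma> \<noteq> 0" "\<tau> \<noteq> 0"
  shows "(\<integral>\<^sup>+w. ennreal (gauss_density \<sigma> (z - w) * gauss_density \<tau> w) \<partial>lborel)
    = ennreal (gauss_density (sqrt (\<sigma>\<^sup>2 + \<tau>\<^sup>2)) z)"
proof -
  let ?N = "normal_density 0"
  have eq: "ennreal (gauss_density \<sigma> (z - w) * gauss_density \<tau> w)
      = ennreal (?N \<bar>\<sigma>\<bar> (Re z - Re w) * ?N \<bar>\<tau>\<bar> (Re w)) * ennreal (?N \<bar>\<sigma>\<bar> (Im z - Im w) * ?N \<bar>\<tau>\<bar> (Im w))" for w
    using assms gauss_density_eq_normal[of "\<bar>\<sigma>\<bar>" "z - w"] gauss_density_eq_normal[of "\<bar>\<tau>\<bar>" w]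
    by (simp add: ennreal_mult'[symmetric] mult_ac)
  have "sqrt (\<sigma>\<^sup>2 + \<tau>\<^sup>2) \<noteq> 0"
    using assms by (simp add: sum_power2_eq_zero_iff)
  moreover have "(\<integral>\<^sup>+y. ennreal (?N \<bar>\<sigma>\<bar> (x - y) * ?N \<bar>\<tau>\<bar> y) \<partial>lborel)
      = ennreal (?N (sqrt (\<sigma>\<^sup>2 + \<tau>\<^sup>2)) x)" for x
    using fun_cong[OF conv_normal_density_zero_mean, of "\<bar>\<sigma>\<bar>" "\<bar>\<tau>\<bar>" x] assms by simp
  moreover have "(\<integral>\<^sup>+w. ennreal (gauss_density \<sigma> (z - w) * gauss_density \<tau> w) \<partial>lborel)
      = (\<integral>\<^sup>+y. ennreal (?N \<bar>\<sigma>\<bar> (Re z - y) * ?N \<bar>\<tau>\<bar> y) \<partial>lborel)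
        * (\<integral>\<^sup>+y. ennreal (?N \<bar>\<sigma>\<bar> (Im z - y) * ?N \<bar>\<tau>\<bar> y) \<partial>lborel)"
    unfolding eq by (rule nn_integral_complex_product) measurable
  ultimately show ?thesis
    by (simp add: gauss_density_eq_normal ennreal_mult)
qed

text \<open>Under the substitution of \<open>h * z\<close> for \<open>z\<close> the Jacobian is
  exactly the ratio of the two normalizing constants. The argument of \<open>h\<close> disappears
  because the density depends on the modulus only.\<close>

lemma nn_integral_gauss_density_divide:
  fixes f :: "complex \<Rightarrow> ennreal"
  assumes [measurable]: "f \<in> borel_measurable borel" and h: "h \<noteq> 0"
  shows "(\<integral>\<^sup>+z. gauss_density \<tau> z * f (z / h) \<partial>lborel) = (\<integral>\<^sup>+z. gauss_density (\<tau> / cmod h) z * f z \<partial>lborel)"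
proof -
  have eq: "gauss_density (\<tau> / cmod h) z = (cmod h)\<^sup>2 * gauss_density \<tau> (h * z)" for z
    using h by (simp add: gauss_density_def norm_mult power_mult_distrib power_divide field_simps)
  show ?thesis
    using h by (subst nn_integral_lborel_complex_mult[of _ h])
      (auto simp: eq ennreal_mult' mult.assoc nn_integral_cmult)
qed

lemma gauss_rectangle:
  fixes A B :: "real set"
  assumes [measurable]: "A \<in> sets borel" "B \<in> sets borel" and \<tau>: "\<tau> \<noteq> 0"
  shows "(\<integral>\<^sup>+z. ennreal (gauss_density \<tau> z) * indicator {z. Re z \<in> A \<and> Im z \<in> B} z \<partial>lborel)
    = emeasure (density lborel (normal_density 0 \<tau>)) A * emeasure (density lborel (normal_density 0 \<tau>)) B"
proof -
  have "ennreal (gauss_density \<tau> z) * indicator {z. Re z \<in> A \<and> Im z \<in> B} z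
      = (ennreal (normal_density 0 \<tau> (Re z)) * indicator A (Re z))
        * (ennreal (normal_density 0 \<tau> (Im z)) * indicator B (Im z))" for z
    using \<tau> by (auto simp: gauss_density_eq_normal ennreal_mult indicator_def)
  then show ?thesis
    using nn_integral_complex_product[of "\<lambda>x. ennreal (normal_density 0 \<tau> x) * indicator A x"
        "\<lambda>x. ennreal (normal_density 0 \<tau> x) * indicator B x"]
    by (simp add: emeasure_density)
qed

section \<open>Voronoi cells of the constellation\<close>

lemma Q_fun_nonneg: "0 \<le> Q_fun x"
  unfolding Q_fun_def set_lebesgue_integral_def by (rule Bochner_Integration.integral_nonneg) auto

lemma emeasure_normal_atLeast:
  assumes "0 < \<tau>"
  shows "emeasure (density lborel (normal_density 0 \<tau>)) {a..} = ennreal (Q_fun (a / \<tau>))"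
proof -
  have "emeasure (density lborel (normal_density 0 \<tau>)) {a..}
      = (\<integral>\<^sup>+x. ennreal (normal_density 0 \<tau> x) * indicator {a..} x \<partial>lborel)"
    by (simp add: emeasure_density)
  also have "\<dots> = \<bar>\<tau>\<bar> * (\<integral>\<^sup>+x. ennreal (normal_density 0 \<tau> (0 + \<tau> * x)) * indicator {a..} (0 + \<tau> * x) \<partial>lborel)"
    using assms by (intro nn_integral_real_affine) auto
  also have "\<dots> = (\<integral>\<^sup>+x. ennreal (indicator {a / \<tau>..} x * (1 / sqrt (2 * pi) * exp (- x\<^sup>2 / 2))) \<partial>lborel)"
  proof (subst nn_integral_cmult[symmetric], simp, rule nn_integral_cong)
    fix x
    have "\<tau> * normal_density 0 \<tau> (\<tau> * x) = 1 / sqrt (2 * pi) * exp (- x\<^sup>2 / 2)"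
      using assms by (simp add: normal_density_def real_sqrt_mult power_mult_distrib)
    moreover have "indicator {a..} (\<tau> * x) = (indicator {a / \<tau>..} x :: ennreal)"
      using assms by (simp add: indicator_def pos_divide_le_eq mult.commute)
    ultimately show "ennreal \<bar>\<tau>\<bar> * (ennreal (normal_density 0 \<tau> (0 + \<tau> * x)) * indicator {a..} (0 + \<tau> * x))
        = ennreal (indicator {a / \<tau>..} x * (1 / sqrt (2 * pi) * exp (- x\<^sup>2 / 2)))"
      using assms by (auto simp: ennreal_mult'[symmetric] indicator_def split: if_splits)
  qed
  also have "\<dots> = ennreal (Q_fun (a / \<tau>))"
    unfolding Q_fun_def set_lebesgue_integral_def real_scaleR_def
  proof (rule nn_integral_eq_integral)
    have "integrable lborel (\<lambda>x. indicator {a / \<tau>..} x *\<^sub>R std_normal_density x)"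
      by (rule integrable_mult_indicator) auto
    then show "integrable lborel (\<lambda>x. indicator {a / \<tau>..} x * (1 / sqrt (2 * pi) * exp (- x\<^sup>2 / 2)))"
      by (simp add: std_normal_density_def)
  qed auto
  finally show ?thesis .
qed

lemma emeasure_normal_atMost:
  assumes "0 < \<tau>"
  shows "emeasure (density lborel (normal_density 0 \<tau>)) {..- a} = ennreal (Q_fun (a / \<tau>))"
proof -
  have "emeasure (density lborel (normal_density 0 \<tau>)) {..- a}
      = (\<integral>\<^sup>+x. ennreal (normal_density 0 \<tau> x) * indicator {..- a} x \<partial>lborel)"
    by (simp add: emeasure_density)
  also have "\<dots> = (\<integral>\<^sup>+x. ennreal (normal_density 0 \<tau> x) * indicator {a..} x \<partial>lborel)"
    by (subst nn_integral_real_affine[where c = "-1" and t = 0])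
       (auto simp: normal_density_def indicator_def)
  also have "\<dots> = emeasure (density lborel (normal_density 0 \<tau>)) {a..}"
    by (simp add: emeasure_density)
  finally show ?thesis
    using assms by (simp add: emeasure_normal_atLeast)
qed

(* The Voronoi cell of the n-th of m equally spaced levels, relative to that level;
   b is half the spacing, and the two outermost cells are unbounded. *)
definition pam_cell :: "nat \<Rightarrow> nat \<Rightarrow> real \<Rightarrow> real set" where
  "pam_cell m n b = {x. (0 < n \<longrightarrow> - b \<le> x) \<and> (Suc n < m \<longrightarrow> x \<le> b)}"

text \<open>Inside the open cell a nearest-level rule has no choice; on its boundary ties may go
  either way. The set on which the level is chosen lies between the two cells.\<close>

definition pam_open_cell :: "nat \<Rightarrow> nat \<Rightarrow> real \<Rightarrow> real set" where
  "pam_open_cell m n b = {x. (0 < n \<longrightarrow> - b < x) \<and> (Suc n < m \<longrightarrow> x < b)}"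

text \<open>The argument \<open>q\<close> is the tail probability beyond half the spacing. Its
  coefficient is 2 inside, 1 at an end and 0 when \<open>m = 1\<close>, so a constellation with a
  single row or column is no special case.\<close>

definition pam_correct :: "nat \<Rightarrow> nat \<Rightarrow> real \<Rightarrow> real" where
  "pam_correct m n q = 1 - (of_bool (0 < n) + of_bool (Suc n < m)) * q"

lemma sets_pam_cell [measurable]: "pam_cell m n b \<in> sets borel"
  unfolding pam_cell_def by measurable

lemma sets_pam_open_cell [measurable]: "pam_open_cell m n b \<in> sets borel"
  unfolding pam_open_cell_def by measurable

text \<open>The complement consists of one tail towards each existing neighbour, and the tails are
  disjoint because \<open>b\<close> is positive. The value is nonnegative as a probability; this
  later allows products of such values to pass through \<open>ennreal\<close>.\<close>

lemma emeasure_normal_pam_open_cell: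
  assumes \<tau>: "0 < \<tau>" and b: "0 < b"
  shows "emeasure (density lborel (normal_density 0 \<tau>)) (pam_open_cell m n b)
      = ennreal (pam_correct m n (Q_fun (b / \<tau>)))"
    and "0 \<le> pam_correct m n (Q_fun (b / \<tau>))"
proof -
  interpret prob_space "density lborel (normal_density 0 \<tau>)"
    using \<tau> by (rule prob_space_normal_density)
  define L where "L = (if 0 < n then {..- b} else {})"
  define R where "R = (if Suc n < m then {b..} else {})"
  have [measurable]: "L \<in> sets borel" "R \<in> sets borel"
    by (auto simp: L_def R_def)
  have "prob L = of_bool (0 < n) * Q_fun (b / \<tau>)" "prob R = of_bool (Suc n < m) * Q_fun (b / \<tau>)"
    using \<tau> by (auto simp: L_def R_def measure_def emeasure_normal_atLeast emeasure_normal_atMost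
        Q_fun_nonneg)
  moreover have "prob (L \<union> R) = prob L + prob R"
    using b by (intro finite_measure_Union) (auto simp: L_def R_def)
  moreover have "pam_open_cell m n b = UNIV - (L \<union> R)"
    by (auto simp: L_def R_def pam_open_cell_def not_le not_less)
  moreover have "prob (UNIV - (L \<union> R)) = 1 - prob (L \<union> R)"
    using prob_compl[of "L \<union> R"] by simp
  ultimately have "prob (pam_open_cell m n b) = pam_correct m n (Q_fun (b / \<tau>))"
    by (simp add: pam_correct_def algebra_simps)
  then show "emeasure (density lborel (normal_density 0 \<tau>)) (pam_open_cell m n b)
      = ennreal (pam_correct m n (Q_fun (b / \<tau>)))" and "0 \<le> pam_correct m n (Q_fun (b / \<tau>))"
    by (simp_all add: emeasure_eq_measure) (metis measure_nonneg)
qed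

text \<open>The closed and the open cell differ at most by the two points \<open>b\<close> and
  \<open>- b\<close>, which are null. Thus both bounds of the squeeze agree.\<close>

lemma emeasure_normal_pam_cell:
  assumes \<tau>: "0 < \<tau>" and b: "0 < b"
  shows "emeasure (density lborel (normal_density 0 \<tau>)) (pam_cell m n b)
      = ennreal (pam_correct m n (Q_fun (b / \<tau>)))"
proof -
  have "AE x in density lborel (normal_density 0 \<tau>). x \<noteq> b \<and> x \<noteq> - b"
    using AE_lborel_singleton[of b] AE_lborel_singleton[of "- b"] by (auto simp: AE_density)
  then have "emeasure (density lborel (normal_density 0 \<tau>)) (pam_cell m n b)
      = emeasure (density lborel (normal_density 0 \<tau>)) (pam_open_cell m n b)"
    by (intro emeasure_eq_AE) (auto simp: pam_cell_def pam_open_cell_def)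
  then show ?thesis
    using emeasure_normal_pam_open_cell[OF assms] by simp
qed

text \<open>Each of the m - 1 gaps between adjacent levels is counted twice, once from either
  side.\<close>

lemma sum_pam_correct: "1 \<le> m \<Longrightarrow> (\<Sum>n<m. pam_correct m n q) = m - 2 * (real m - 1) * q"
proof -
  assume m: "1 \<le> m"
  then obtain k where k: "m = Suc k"
    by (cases m) auto
  have "(\<Sum>n<m. of_bool (0 < n)) = real k"
    unfolding k by (simp add: sum.lessThan_Suc_shift del: sum.lessThan_Suc)
  moreover have "(\<Sum>n<m. of_bool (Suc n < m)) = real k"
    unfolding k by simp
  moreover have "(\<Sum>n<m. pam_correct m n q)
      = m - ((\<Sum>n<m. of_bool (0 < n)) + (\<Sum>n<m. of_bool (Suc n < m))) * q"
    unfolding pam_correct_def sum_subtractf sum_distrib_right[symmetric] sum.distrib by simp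
  ultimately show ?thesis
    by (simp add: k)
qed

section \<open>Nearest points on the grid of levels\<close>

definition pam_level :: "nat \<Rightarrow> real \<Rightarrow> nat \<Rightarrow> real" where
  "pam_level m d n = (2 * real n + 1 - real m) * (d / 2)"

lemma pam_level_diff: "pam_level m d n - pam_level m d n' = (real n - real n') * d"
  by (simp add: pam_level_def algebra_simps diff_divide_distrib add_divide_distrib)

text \<open>A competing level lies at least \<open>d\<close> away on one side, and towards that side
  \<open>x\<close> deviates by less than \<open>d / 2\<close>. Where the cell is unbounded there is
  no competitor.\<close>

lemma pam_open_cell_nearest:
  assumes d: "0 < d" and x: "x - pam_level m d n \<in> pam_open_cell m n (d / 2)"
    and n: "n < m" "n' < m" "n' \<noteq> n"
  shows "\<bar>x - pam_level m d n\<bar> < \<bar>x - pam_level m d n'\<bar>"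
proof (cases "n' < n")
  case True
  then have "1 * d \<le> pam_level m d n - pam_level m d n'"
    unfolding pam_level_diff using d by (intro mult_right_mono) auto
  moreover have "- (d / 2) < x - pam_level m d n"
    using x True by (auto simp: pam_open_cell_def)
  ultimately show ?thesis using d by linarith
next
  case False
  then have "1 * d \<le> pam_level m d n' - pam_level m d n"
    unfolding pam_level_diff using d n by (intro mult_right_mono) auto
  moreover have "x - pam_level m d n < d / 2"
    using x False n by (auto simp: pam_open_cell_def)
  ultimately show ?thesis using d by linarith
qed

text \<open>Comparison with the adjacent levels is enough, since the midpoints to them are the ends
  of the cell.\<close>

lemma nearest_pam_cell:
  assumes d: "0 < d" and n: "n < m"
    and near: "\<And>n'. n' < m \<Longrightarrow> \<bar>x - pam_level m d n\<bar> \<le> \<bar>x - pam_level m d n'\<bar>"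
  shows "x - pam_level m d n \<in> pam_cell m n (d / 2)"
  unfolding pam_cell_def
proof (intro CollectI conjI impI)
  assume "0 < n"
  then have "pam_level m d n - pam_level m d (n - 1) = d"
    unfolding pam_level_diff by (simp add: of_nat_diff)
  with near[of "n - 1"] n d show "- (d / 2) \<le> x - pam_level m d n" by linarith
next
  assume "Suc n < m"
  moreover have "pam_level m d (Suc n) - pam_level m d n = d"
    unfolding pam_level_diff by simp
  ultimately show "x - pam_level m d n \<le> d / 2"
    using near[of "Suc n"] d by linarith
qed

definition qam_point :: "nat \<Rightarrow> nat \<Rightarrow> real \<Rightarrow> nat \<times> nat \<Rightarrow> complex" where
  "qam_point m m' d = (\<lambda>(n, q). Complex (pam_level m d n) (pam_level m' d q))"

lemma qam_points_eq: "qam_points m m' P = qam_point m m' (d_min m m' P) ` ({..<m} \<times> {..<m'})"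
  by (auto simp: qam_points_def qam_point_def pam_level_def)

text \<open>Distinct index pairs are distinct symbols, which makes the events indexed by pairs
  disjoint.\<close>

lemma inj_qam_point:
  assumes "0 < d" shows "inj (qam_point m m' d)"
proof (rule injI)
  fix z z' assume eq: "qam_point m m' d z = qam_point m m' d z'"
  have "(real (fst z) - real (fst z')) * d = 0"
    unfolding pam_level_diff[of m d, symmetric] using eq by (simp add: qam_point_def case_prod_beta)
  moreover have "(real (snd z) - real (snd z')) * d = 0"
    unfolding pam_level_diff[of m' d, symmetric] using eq by (simp add: qam_point_def case_prod_beta)
  ultimately show "z = z'" using assms by (simp add: prod_eq_iff)
qed

lemma cmod_less_iff: "cmod z < cmod w \<longleftrightarrow> (Re z)\<^sup>2 + (Im z)\<^sup>2 < (Re w)\<^sup>2 + (Im w)\<^sup>2"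
  by (simp add: cmod_def)

text \<open>The squared distance is the sum of the coordinate squares. A coordinate whose index
  differs grows strictly, the other one is unchanged, and at least one index differs.\<close>

lemma qam_open_cell_nearest:
  assumes d: "0 < d"
    and cell: "Re (u - qam_point m m' d (n, q)) \<in> pam_open_cell m n (d / 2)"
      "Im (u - qam_point m m' d (n, q)) \<in> pam_open_cell m' q (d / 2)"
    and ind: "n < m" "q < m'" "n' < m" "q' < m'" "(n', q') \<noteq> (n, q)"
  shows "cmod (u - qam_point m m' d (n, q)) < cmod (u - qam_point m m' d (n', q'))"
proof -
  have n: "n' \<noteq> n \<Longrightarrow> (Re u - pam_level m d n)\<^sup>2 < (Re u - pam_level m d n')\<^sup>2"
    using pam_open_cell_nearest[OF d, of "Re u" m n n'] cell ind
    by (simp add: qam_point_def) (metis abs_le_square_iff not_le)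
  have q: "q' \<noteq> q \<Longrightarrow> (Im u - pam_level m' d q)\<^sup>2 < (Im u - pam_level m' d q')\<^sup>2"
    using pam_open_cell_nearest[OF d, of "Im u" m' q q'] cell ind
    by (simp add: qam_point_def) (metis abs_le_square_iff not_le)
  show ?thesis
    using n q ind(5) by (cases "n' = n"; cases "q' = q") (auto simp: cmod_less_iff qam_point_def)
qed

text \<open>Changing one index at a time leaves the other coordinate fixed, so its square cancels
  and a comparison on the line remains.\<close>

lemma nearest_qam_cell:
  assumes d: "0 < d" and ind: "n < m" "q < m'"
    and near: "\<And>n' q'. n' < m \<Longrightarrow> q' < m' \<Longrightarrow>
      cmod (u - qam_point m m' d (n, q)) \<le> cmod (u - qam_point m m' d (n', q'))"
  shows "Re (u - qam_point m m' d (n, q)) \<in> pam_cell m n (d / 2)"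
    and "Im (u - qam_point m m' d (n, q)) \<in> pam_cell m' q (d / 2)"
proof -
  have "Re u - pam_level m d n \<in> pam_cell m n (d / 2)"
  proof (rule nearest_pam_cell[OF d ind(1)])
    fix n' assume "n' < m"
    then show "\<bar>Re u - pam_level m d n\<bar> \<le> \<bar>Re u - pam_level m d n'\<bar>"
      using near[of n' q] ind by (simp add: qam_point_def cmod_def abs_le_square_iff)
  qed
  then show "Re (u - qam_point m m' d (n, q)) \<in> pam_cell m n (d / 2)"
    by (simp add: qam_point_def)
  have "Im u - pam_level m' d q \<in> pam_cell m' q (d / 2)"
  proof (rule nearest_pam_cell[OF d ind(2)])
    fix q' assume "q' < m'"
    then show "\<bar>Im u - pam_level m' d q\<bar> \<le> \<bar>Im u - pam_level m' d q'\<bar>"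
      using near[of n q'] ind by (simp add: qam_point_def cmod_def abs_le_square_iff)
  qed
  then show "Im (u - qam_point m m' d (n, q)) \<in> pam_cell m' q (d / 2)"
    by (simp add: qam_point_def)
qed

section \<open>Minimum distance detection in Gaussian mixture noise\<close>

lemma mixture_density_nonneg:
  "(\<And>l. l \<in> {1..p} \<Longrightarrow> 0 \<le> lam l) \<Longrightarrow> 0 \<le> mixture_density p lam \<tau> z"
  unfolding mixture_density_def by (intro sum_nonneg mult_nonneg_nonneg) auto

lemma borel_measurable_mixture_density [measurable]: "mixture_density p lam \<tau> \<in> borel_measurable borel"
  unfolding mixture_density_def by measurable

lemma mixture_density_strict_antimono:
  assumes \<tau>: "\<And>l. l \<in> {1..p} \<Longrightarrow> \<tau> l \<noteq> 0" and lam: "\<And>l. l \<in> {1..p} \<Longrightarrow> 0 \<le> lam l"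
    and sum: "(\<Sum>l=1..p. lam l) = 1" and less: "cmod z < cmod w"
  shows "mixture_density p lam \<tau> w < mixture_density p lam \<tau> z"
proof -
  \<comment> \<open>Weights may vanish, but they sum to 1; a component of positive weight makes the
    inequality strict.\<close>
  obtain l where l: "l \<in> {1..p}" "lam l \<noteq> 0"
    using sum by (metis sum.neutral zero_neq_one)
  show ?thesis
    unfolding mixture_density_def
  proof (rule sum_strict_mono_ex1)
    show "\<forall>l\<in>{1..p}. lam l * gauss_density (\<tau> l) w \<le> lam l * gauss_density (\<tau> l) z"
      using gauss_density_strict_antimono[OF \<tau> less] lam by (auto intro!: mult_left_mono simp: less_imp_le)
    have "lam l * gauss_density (\<tau> l) w < lam l * gauss_density (\<tau> l) z"
      using l(2) lam[OF l(1)] by (intro mult_strict_left_mono gauss_density_strict_antimono[OF \<tau>[OF l(1)] less]) auto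
    with l(1) show "\<exists>l\<in>{1..p}. lam l * gauss_density (\<tau> l) w < lam l * gauss_density (\<tau> l) z" ..
  qed simp
qed

text \<open>By linearity one component suffices, and there the coordinates are independent. The side
  probabilities \<alpha> and \<beta> depend on the component, so the sum stays outside their
  product.\<close>

lemma mixture_rectangle:
  fixes A B :: "real set"
  assumes \<tau>: "\<And>l. l \<in> {1..p} \<Longrightarrow> \<tau> l \<noteq> 0" and lam: "\<And>l. l \<in> {1..p} \<Longrightarrow> 0 \<le> lam l"
    and h: "h \<noteq> 0" and [measurable]: "A \<in> sets borel" "B \<in> sets borel"
    and A: "\<And>l. l \<in> {1..p} \<Longrightarrow> emeasure (density lborel (normal_density 0 (\<bar>\<tau> l\<bar> / cmod h))) A = ennreal (\<alpha> l)"
    and B: "\<And>l. l \<in> {1..p} \<Longrightarrow> emeasure (density lborel (normal_density 0 (\<bar>\<tau> l\<bar> / cmod h))) B = ennreal (\<beta> l)"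
    and nonneg: "\<And>l. l \<in> {1..p} \<Longrightarrow> 0 \<le> \<alpha> l" "\<And>l. l \<in> {1..p} \<Longrightarrow> 0 \<le> \<beta> l"
  shows "(\<integral>\<^sup>+v. ennreal (mixture_density p lam \<tau> v) * indicator {z. Re z \<in> A \<and> Im z \<in> B} (v / h) \<partial>lborel)
    = ennreal (\<Sum>l=1..p. lam l * (\<alpha> l * \<beta> l))"
proof -
  let ?F = "indicator {z. Re z \<in> A \<and> Im z \<in> B} :: complex \<Rightarrow> ennreal"
  have "ennreal (mixture_density p lam \<tau> v) * ?F (v / h)
      = (\<Sum>l=1..p. ennreal (lam l) * (ennreal (gauss_density \<bar>\<tau> l\<bar> v) * ?F (v / h)))" for v
    unfolding mixture_density_def using lam
    by (subst sum_ennreal[symmetric])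
       (auto simp: ennreal_mult sum_distrib_right mult.assoc simp del: sum_ennreal)
  then have "(\<integral>\<^sup>+v. ennreal (mixture_density p lam \<tau> v) * ?F (v / h) \<partial>lborel)
      = (\<Sum>l=1..p. ennreal (lam l) * (\<integral>\<^sup>+v. ennreal (gauss_density \<bar>\<tau> l\<bar> v) * ?F (v / h) \<partial>lborel))"
    by (simp add: nn_integral_sum nn_integral_cmult)
  also have "\<dots> = (\<Sum>l=1..p. ennreal (lam l * (\<alpha> l * \<beta> l)))"
  proof (rule sum.cong[OF refl])
    fix l assume l: "l \<in> {1..p}"
    have "(\<integral>\<^sup>+v. ennreal (gauss_density \<bar>\<tau> l\<bar> v) * ?F (v / h) \<partial>lborel)
        = (\<integral>\<^sup>+v. ennreal (gauss_density (\<bar>\<tau> l\<bar> / cmod h) v) * ?F v \<partial>lborel)"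
      using h by (intro nn_integral_gauss_density_divide) measurable
    also have "\<dots> = ennreal (\<alpha> l) * ennreal (\<beta> l)"
      using h \<tau>[OF l] A[OF l] B[OF l] by (subst gauss_rectangle) auto
    finally show "ennreal (lam l) * (\<integral>\<^sup>+v. ennreal (gauss_density \<bar>\<tau> l\<bar> v) * ?F (v / h) \<partial>lborel)
        = ennreal (lam l * (\<alpha> l * \<beta> l))"
      using lam[OF l] nonneg[OF l] by (simp add: ennreal_mult)
  qed
  also have "\<dots> = ennreal (\<Sum>l=1..p. lam l * (\<alpha> l * \<beta> l))"
    using lam nonneg by (intro sum_ennreal) auto
  finally show ?thesis .
qed

text \<open>Here \<open>R\<close> stands for the disturbances under which one given symbol is
  decided correctly. Only the squeeze between the two cells, scaled and rotated by \<open>h\<close>,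
  is known about it.\<close>

lemma mixture_cell:
  assumes \<tau>: "\<And>l. l \<in> {1..p} \<Longrightarrow> \<tau> l \<noteq> 0" and lam: "\<And>l. l \<in> {1..p} \<Longrightarrow> 0 \<le> lam l"
    and h: "h \<noteq> 0" and d: "0 < d" and R [measurable]: "R \<in> sets borel"
    and lower: "AE v in lborel. Re (v / h) \<in> pam_open_cell m n (d / 2) \<and>
        Im (v / h) \<in> pam_open_cell m' q (d / 2) \<longrightarrow> v \<in> R"
    and upper: "AE v in lborel. v \<in> R \<longrightarrow>
        Re (v / h) \<in> pam_cell m n (d / 2) \<and> Im (v / h) \<in> pam_cell m' q (d / 2)"
  defines "a \<equiv> \<lambda>l. sqrt (d\<^sup>2 * (cmod h)\<^sup>2 / (4 * (\<tau> l)\<^sup>2))"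
  shows "(\<integral>\<^sup>+v. ennreal (mixture_density p lam \<tau> v) * indicator R v \<partial>lborel)
    = ennreal (\<Sum>l=1..p. lam l * (pam_correct m n (Q_fun (a l)) * pam_correct m' q (Q_fun (a l))))"
proof -
  let ?g = "\<lambda>v. ennreal (mixture_density p lam \<tau> v)"
  let ?val = "ennreal (\<Sum>l=1..p. lam l * (pam_correct m n (Q_fun (a l)) * pam_correct m' q (Q_fun (a l))))"
  have a: "a l = d / 2 / (\<bar>\<tau> l\<bar> / cmod h)" for l
    using d by (simp add: a_def real_sqrt_divide real_sqrt_mult)
  have pos: "0 < \<bar>\<tau> l\<bar> / cmod h" if "l \<in> {1..p}" for l
    using \<tau>[OF that] h by simp
  have d2: "0 < d / 2" using d by simp
  have nonneg: "0 \<le> pam_correct m n (Q_fun (a l))" if "l \<in> {1..p}" for l m n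
    unfolding a by (rule emeasure_normal_pam_open_cell(2)[OF pos[OF that] d2])
  have "emeasure (density lborel (normal_density 0 (\<bar>\<tau> l\<bar> / cmod h))) (pam_open_cell m n (d / 2))
      = ennreal (pam_correct m n (Q_fun (a l)))" if "l \<in> {1..p}" for l m n
    unfolding a by (rule emeasure_normal_pam_open_cell(1)[OF pos[OF that] d2])
  then have open_cell: "(\<integral>\<^sup>+v. ?g v * indicator {z. Re z \<in> pam_open_cell m n (d / 2) \<and>
      Im z \<in> pam_open_cell m' q (d / 2)} (v / h) \<partial>lborel) = ?val"
    by (intro mixture_rectangle[OF \<tau> lam h] nonneg) auto
  have "emeasure (density lborel (normal_density 0 (\<bar>\<tau> l\<bar> / cmod h))) (pam_cell m n (d / 2))
      = ennreal (pam_correct m n (Q_fun (a l)))" if "l \<in> {1..p}" for l m n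
    unfolding a by (rule emeasure_normal_pam_cell[OF pos[OF that] d2])
  then have closed_cell: "(\<integral>\<^sup>+v. ?g v * indicator {z. Re z \<in> pam_cell m n (d / 2) \<and>
      Im z \<in> pam_cell m' q (d / 2)} (v / h) \<partial>lborel) = ?val"
    by (intro mixture_rectangle[OF \<tau> lam h] nonneg) auto
  show ?thesis
  proof (rule antisym)
    show "(\<integral>\<^sup>+v. ?g v * indicator R v \<partial>lborel) \<le> ?val"
      unfolding closed_cell[symmetric]
      by (rule nn_integral_mono_AE) (use upper in \<open>auto simp: indicator_def\<close>)
    show "?val \<le> (\<integral>\<^sup>+v. ?g v * indicator R v \<partial>lborel)"
      unfolding open_cell[symmetric]
      by (rule nn_integral_mono_AE) (use lower in \<open>auto simp: indicator_def\<close>)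
  qed
qed

lemma AE_lborel_translate:
  fixes c :: "'b::euclidean_space"
  assumes "AE y in lborel. P y"
  shows "AE v in lborel. P (c + v)"
proof -
  have "AE y in distr lborel borel ((+) c). P y"
    using assms unfolding lborel_distr_plus .
  then show ?thesis by (rule AE_distrD[rotated]) simp
qed

text \<open>The decision rule enters only through being almost everywhere a minimum distance rule.
  The lemma is meant for the measure conditioned on a decision and a state.\<close>

lemma (in prob_space) qam_error_probability:
  fixes S V :: "'a \<Rightarrow> complex" and det :: "complex \<Rightarrow> complex"
  defines "C \<equiv> \<lambda>m m' d. qam_point m m' d ` ({..<m} \<times> {..<m'})"
  assumes indep: "indep_var borel S borel V"
    and V: "distributed M lborel V (\<lambda>z. ennreal (mixture_density p lam \<tau> z))"
    and det [measurable]: "det \<in> borel_measurable borel"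
    and \<tau>: "\<And>l. l \<in> {1..p} \<Longrightarrow> \<tau> l \<noteq> 0" and lam: "\<And>l. l \<in> {1..p} \<Longrightarrow> 0 \<le> lam l"
    and sum_lam: "(\<Sum>l=1..p. lam l) = 1"
    and h: "h \<noteq> 0" and d: "0 < d" and m: "1 \<le> m" "1 \<le> m'"
    and uniform: "\<And>s. s \<in> C m m' d \<Longrightarrow> prob {\<omega> \<in> space M. S \<omega> = s} = 1 / (real m * real m')"
    and near: "AE y in lborel. \<forall>s\<in>C m m' d. cmod (y - h * det y) \<le> cmod (y - h * s)"
    and det_C: "\<And>y. det y \<in> C m m' d"
  defines "a \<equiv> \<lambda>l. sqrt (d\<^sup>2 * (cmod h)\<^sup>2 / (4 * (\<tau> l)\<^sup>2))"
  shows "prob {\<omega> \<in> space M. det (h * S \<omega> + V \<omega>) \<noteq> S \<omega>}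
    = 2 * (2 - 1 / real m - 1 / real m') * (\<Sum>l=1..p. lam l * Q_fun (a l))
      - 4 * (1 - 1 / real m) * (1 - 1 / real m') * (\<Sum>l=1..p. lam l * (Q_fun (a l))\<^sup>2)"
proof -
  let ?I = "{..<m} \<times> {..<m'}"
  let ?pt = "qam_point m m' d"
  have [measurable]: "S \<in> borel_measurable M" "V \<in> borel_measurable M"
    using indep_var_rv1[OF indep] indep_var_rv2[OF indep] by auto
  have inj: "inj_on ?pt ?I"
    using inj_qam_point[OF d] by (rule inj_on_subset) simp
  define R where "R i = {v. det (h * ?pt i + v) = ?pt i}" for i
  have R [measurable]: "R i \<in> sets borel" for i
    unfolding R_def by measurable
  define c where "c = (\<lambda>(n, q). \<Sum>l=1..p. lam l * (pam_correct m n (Q_fun (a l)) * pam_correct m' q (Q_fun (a l))))"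
  have cell_prob: "prob (V -` R i \<inter> space M) = c i" if i_in: "i \<in> ?I" for i
  proof -
    obtain n q where i: "i = (n, q)" "n < m" "q < m'" using i_in by auto
    \<comment> \<open>After division by \<open>h\<close> the received point is
      \<open>v / h + ?pt i\<close>, in the coordinates of the unfaded constellation.\<close>
    have near': "AE v in lborel. \<forall>s\<in>C m m' d.
        cmod (v / h + ?pt i - det (h * ?pt i + v)) \<le> cmod (v / h + ?pt i - s)"
    proof -
      have "cmod (v / h + ?pt i - s) = cmod (h * ?pt i + v - h * s) / cmod h" for v s
        using h by (simp add: norm_divide[symmetric] field_simps)
      then show ?thesis
        using AE_lborel_translate[OF near, of "h * ?pt i"] h by (auto simp: divide_right_mono)
    qed
    have "emeasure M (V -` R i \<inter> space M) = (\<integral>\<^sup>+v. ennreal (mixture_density p lam \<tau> v) * indicator (R i) v \<partial>lborel)"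
      by (rule distributed_emeasure[OF V]) simp
    also have "\<dots> = ennreal (c i)"
      unfolding c_def i(1) prod.case a_def
    proof (rule mixture_cell[OF \<tau> lam h d])
      show "AE v in lborel. Re (v / h) \<in> pam_open_cell m n (d / 2) \<and>
        Im (v / h) \<in> pam_open_cell m' q (d / 2) \<longrightarrow> v \<in> R (n, q)"
        using near'
      proof eventually_elim
        case (elim v)
        obtain n' q' where t: "det (h * ?pt i + v) = ?pt (n', q')" "n' < m" "q' < m'"
          using det_C[of "h * ?pt i + v"] by (auto simp: C_def)
        \<comment> \<open>In the open cell every other symbol is strictly farther away, so the
          decided symbol must be the transmitted one.\<close>
        have "cmod (v / h + ?pt i - ?pt (n', q')) \<le> cmod (v / h + ?pt i - ?pt (n, q))"
          using bspec[OF elim, of "?pt (n, q)"] i t by (auto simp: C_def)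
        then show ?case
          using qam_open_cell_nearest[OF d, of "v / h + ?pt i" m m' n q n' q'] i t
          by (fastforce simp: R_def)
      qed
      show "AE v in lborel. v \<in> R (n, q) \<longrightarrow>
        Re (v / h) \<in> pam_cell m n (d / 2) \<and> Im (v / h) \<in> pam_cell m' q (d / 2)"
        using near'
      proof eventually_elim
        case (elim v)
        then show ?case
          using nearest_qam_cell[OF d, of n m q m' "v / h + ?pt i"] i by (auto simp: R_def C_def)
      qed
    qed simp_all
    finally have "prob (V -` R i \<inter> space M) = enn2real (ennreal (c i))"
      by (simp add: measure_def)
    moreover have "0 \<le> c i"
      unfolding c_def i(1) prod.case
    proof (intro sum_nonneg mult_nonneg_nonneg lam)
      fix l assume l: "l \<in> {1..p}"
      have al: "a l = d / 2 / (\<bar>\<tau> l\<bar> / cmod h)"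
        using d by (simp add: a_def real_sqrt_divide real_sqrt_mult)
      show "0 \<le> pam_correct m n (Q_fun (a l))" "0 \<le> pam_correct m' q (Q_fun (a l))"
        unfolding al using \<tau>[OF l] h d by (intro emeasure_normal_pam_open_cell(2); simp)+
    qed simp
    ultimately show ?thesis by simp
  qed
  define E where "E i = {\<omega> \<in> space M. S \<omega> = ?pt i \<and> V \<omega> \<in> R i}" for i
  have E [measurable]: "E i \<in> sets M" for i
    unfolding E_def by measurable
  have prob_E: "prob (E i) = 1 / (real m * real m') * c i" if "i \<in> ?I" for i
  proof -
    have "E i = (\<lambda>x. (S x, V x)) -` ({?pt i} \<times> R i) \<inter> space M"
      by (auto simp: E_def)
    also have "prob \<dots> = prob (S -` {?pt i} \<inter> space M) * prob (V -` R i \<inter> space M)"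
      using indep by (rule indep_varD) auto
    also have "S -` {?pt i} \<inter> space M = {\<omega> \<in> space M. S \<omega> = ?pt i}" by auto
    finally show ?thesis
      using that cell_prob[OF that] uniform[of "?pt i"] by (auto simp: C_def)
  qed
  \<comment> \<open>Uniformity prescribes the mass of each constellation point only. These masses
    add up to 1, so almost surely no other symbol is sent.\<close>
  have S_C: "AE \<omega> in M. S \<omega> \<in> C m m' d"
  proof -
    have "{\<omega> \<in> space M. S \<omega> \<in> C m m' d} = (\<Union>i\<in>?I. {\<omega> \<in> space M. S \<omega> = ?pt i})"
      by (auto simp: C_def)
    also have "prob \<dots> = (\<Sum>i\<in>?I. prob {\<omega> \<in> space M. S \<omega> = ?pt i})"
      using inj by (intro finite_measure_finite_Union) (auto simp: disjoint_family_on_def inj_on_def)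
    also have "\<dots> = (\<Sum>i\<in>?I. 1 / (real m * real m'))"
      by (intro sum.cong refl uniform) (auto simp: C_def)
    also have "\<dots> = 1" using m by simp
    finally have "prob {\<omega> \<in> space M. S \<omega> \<in> C m m' d} = 1" .
    moreover have [measurable]: "C m m' d \<in> sets borel"
      unfolding C_def by (intro borel_closed finite_imp_closed) simp
    ultimately show ?thesis
      by (subst (asm) prob_eq_1) auto
  qed
  have "(\<Sum>i\<in>?I. c i) = (\<Sum>n<m. \<Sum>q<m'. \<Sum>l=1..p. lam l * (pam_correct m n (Q_fun (a l)) * pam_correct m' q (Q_fun (a l))))"
    by (simp add: c_def sum.cartesian_product')
  also have "\<dots> = (\<Sum>n<m. \<Sum>l=1..p. \<Sum>q<m'. lam l * (pam_correct m n (Q_fun (a l)) * pam_correct m' q (Q_fun (a l))))"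
    by (intro sum.cong refl sum.swap)
  also have "\<dots> = (\<Sum>l=1..p. \<Sum>n<m. \<Sum>q<m'. lam l * (pam_correct m n (Q_fun (a l)) * pam_correct m' q (Q_fun (a l))))"
    by (rule sum.swap)
  also have "\<dots> = (\<Sum>l=1..p. lam l * ((\<Sum>n<m. pam_correct m n (Q_fun (a l))) *
      (\<Sum>q<m'. pam_correct m' q (Q_fun (a l)))))"
    unfolding sum_product by (simp add: sum_distrib_left)
  finally have sum_c: "(\<Sum>i\<in>?I. c i) = (\<Sum>l=1..p. lam l *
      ((m - 2 * (real m - 1) * Q_fun (a l)) * (m' - 2 * (real m' - 1) * Q_fun (a l))))"
    using m by (simp add: sum_pam_correct)
  \<comment> \<open>The constant 1 is the sum of the weights, which brings the complement under the
    sum over components.\<close>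
  have average: "1 - x * (\<Sum>l=1..p. lam l * y l) = (\<Sum>l=1..p. lam l * (1 - x * y l))" for x y
    unfolding right_diff_distrib sum_subtractf sum_distrib_left using sum_lam by (simp add: mult.left_commute)
  let ?err = "{\<omega> \<in> space M. det (h * S \<omega> + V \<omega>) \<noteq> S \<omega>}"
  have "1 - prob ?err = prob (space M - ?err)"
    by (rule prob_compl[symmetric]) measurable
  also have "\<dots> = prob (\<Union>i\<in>?I. E i)"
  proof (rule measure_eq_AE)
    show "AE \<omega> in M. \<omega> \<in> space M - ?err \<longleftrightarrow> \<omega> \<in> (\<Union>i\<in>?I. E i)"
      using S_C AE_space by eventually_elim (auto simp: E_def R_def C_def; blast)
  qed measurable
  also have "\<dots> = (\<Sum>i\<in>?I. prob (E i))"
    using inj by (intro finite_measure_finite_Union) (auto simp: disjoint_family_on_def E_def inj_on_def)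
  also have "\<dots> = 1 / (real m * real m') * (\<Sum>i\<in>?I. c i)"
    unfolding sum_distrib_left by (intro sum.cong refl prob_E)
  finally have "prob ?err = 1 - 1 / (real m * real m') * (\<Sum>l=1..p. lam l *
      ((m - 2 * (real m - 1) * Q_fun (a l)) * (m' - 2 * (real m' - 1) * Q_fun (a l))))"
    unfolding sum_c by simp
  also have "\<dots> = (\<Sum>l=1..p. lam l * (1 - 1 / (real m * real m') *
      ((m - 2 * (real m - 1) * Q_fun (a l)) * (m' - 2 * (real m' - 1) * Q_fun (a l)))))"
    by (rule average)
  \<comment> \<open>With u = 2 (1 - 1/m) Q and u' = 2 (1 - 1/m') Q this is 1 - (1 - u) (1 - u') = u
    + u' - u u'.\<close>
  also have "\<dots> = (\<Sum>l=1..p. 2 * (2 - 1 / real m - 1 / real m') * (lam l * Q_fun (a l))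
      - 4 * (1 - 1 / real m) * (1 - 1 / real m') * (lam l * (Q_fun (a l))\<^sup>2))"
    using m by (intro sum.cong refl) (simp add: field_simps power2_eq_square)
  finally show ?thesis
    by (simp add: sum_subtractf sum_distrib_left)
qed

section \<open>Conditional law of the received signal\<close>

text \<open>The joint density is a product. For fixed second variable, translation invariance turns
  the first variable into the sum, and Fubini then integrates out the second.\<close>

lemma (in prob_space) distributed_convolution_euclidean:
  fixes X Y :: "'a \<Rightarrow> 'b::euclidean_space"
  assumes indep: "indep_var borel X borel Y"
    and X: "distributed M lborel X f" and Y: "distributed M lborel Y g"
  shows "distributed M lborel (\<lambda>\<omega>. X \<omega> + Y \<omega>) (\<lambda>z. \<integral>\<^sup>+y. f (z - y) * g y \<partial>lborel)"
  unfolding distributed_def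
proof (intro conjI measure_eqI)
  have [measurable]: "f \<in> borel_measurable borel" "g \<in> borel_measurable borel"
    "X \<in> borel_measurable M" "Y \<in> borel_measurable M"
    using distributed_borel_measurable[OF X] distributed_borel_measurable[OF Y]
      distributed_measurable[OF X] distributed_measurable[OF Y] by simp_all
  show "(\<lambda>\<omega>. X \<omega> + Y \<omega>) \<in> measurable M lborel" by simp
  show dens [measurable]: "(\<lambda>z. \<integral>\<^sup>+y. f (z - y) * g y \<partial>lborel) \<in> borel_measurable lborel" by simp
  fix A assume "A \<in> sets (distr M lborel (\<lambda>\<omega>. X \<omega> + Y \<omega>))"
  then have A [measurable]: "A \<in> sets borel" by simp
  have indep': "indep_var lborel X lborel Y"
    using indep by (simp add: indep_var_eq)
  have joint: "distributed M (lborel \<Otimes>\<^sub>M lborel) (\<lambda>\<omega>. (X \<omega>, Y \<omega>)) (\<lambda>(x, y). f x * g y)"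
    by (intro distributed_joint_indep X Y indep' sigma_finite_lborel)
  have "emeasure (distr M lborel (\<lambda>\<omega>. X \<omega> + Y \<omega>)) A = (\<integral>\<^sup>+\<omega>. indicator A (X \<omega> + Y \<omega>) \<partial>M)"
    by (subst nn_integral_distr[symmetric, of "\<lambda>\<omega>. X \<omega> + Y \<omega>" M lborel]) auto
  also have "\<dots> = (\<integral>\<^sup>+z. (\<lambda>(x, y). f x * g y) z * indicator A (fst z + snd z) \<partial>(lborel \<Otimes>\<^sub>M lborel))"
    by (subst distributed_nn_integral[OF joint]) auto
  also have "\<dots> = (\<integral>\<^sup>+y. \<integral>\<^sup>+x. f x * g y * indicator A (x + y) \<partial>lborel \<partial>lborel)"
    by (subst lborel_pair.nn_integral_snd[symmetric]) auto
  also have "\<dots> = (\<integral>\<^sup>+y. \<integral>\<^sup>+z. f (z - y) * g y * indicator A z \<partial>lborel \<partial>lborel)"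
  proof (rule nn_integral_cong)
    fix y :: 'b
    show "(\<integral>\<^sup>+x. f x * g y * indicator A (x + y) \<partial>lborel) = (\<integral>\<^sup>+z. f (z - y) * g y * indicator A z \<partial>lborel)"
      using nn_integral_lborel_translate[of "\<lambda>z. f (z - y) * g y * indicator A z" y]
      by (simp add: add.commute)
  qed
  also have "\<dots> = (\<integral>\<^sup>+z. \<integral>\<^sup>+y. f (z - y) * g y * indicator A z \<partial>lborel \<partial>lborel)"
    by (rule lborel_pair.Fubini') simp
  also have "\<dots> = emeasure (density lborel (\<lambda>z. \<integral>\<^sup>+y. f (z - y) * g y \<partial>lborel)) A"
    by (simp add: emeasure_density nn_integral_multc)
  finally show "emeasure (distr M lborel (\<lambda>\<omega>. X \<omega> + Y \<omega>)) A
      = emeasure (density lborel (\<lambda>z. \<integral>\<^sup>+y. f (z - y) * g y \<partial>lborel)) A" .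
qed simp

lemma conv_gauss_mixture_density:
  assumes "\<sigma>\<^sub>n \<noteq> 0" and \<sigma>: "\<And>l. l \<in> {1..p} \<Longrightarrow> \<sigma> l \<noteq> 0" and lam: "\<And>l. l \<in> {1..p} \<Longrightarrow> 0 \<le> lam l"
  shows "(\<integral>\<^sup>+w. ennreal (gauss_density \<sigma>\<^sub>n (z - w)) * ennreal (mixture_density p lam \<sigma> w) \<partial>lborel)
    = ennreal (mixture_density p lam (\<lambda>l. sqrt ((\<sigma> l)\<^sup>2 + \<sigma>\<^sub>n\<^sup>2)) z)"
proof -
  have "ennreal (gauss_density \<sigma>\<^sub>n (z - w)) * ennreal (mixture_density p lam \<sigma> w)
      = (\<Sum>l=1..p. ennreal (lam l) * ennreal (gauss_density \<sigma>\<^sub>n (z - w) * gauss_density (\<sigma> l) w))" for w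
    unfolding mixture_density_def using lam
    by (subst sum_ennreal[symmetric])
       (auto simp: ennreal_mult sum_distrib_left mult.left_commute simp del: sum_ennreal)
  then have "(\<integral>\<^sup>+w. ennreal (gauss_density \<sigma>\<^sub>n (z - w)) * ennreal (mixture_density p lam \<sigma> w) \<partial>lborel)
      = (\<Sum>l=1..p. ennreal (lam l) *
          (\<integral>\<^sup>+w. ennreal (gauss_density \<sigma>\<^sub>n (z - w) * gauss_density (\<sigma> l) w) \<partial>lborel))"
    by (simp add: nn_integral_sum nn_integral_cmult)
  also have "\<dots> = (\<Sum>l=1..p. ennreal (lam l * gauss_density (sqrt ((\<sigma> l)\<^sup>2 + \<sigma>\<^sub>n\<^sup>2)) z))"
    using assms by (intro sum.cong refl, subst conv_gauss_density) (auto simp: ennreal_mult add.commute)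
  also have "\<dots> = ennreal (mixture_density p lam (\<lambda>l. sqrt ((\<sigma> l)\<^sup>2 + \<sigma>\<^sub>n\<^sup>2)) z)"
    unfolding mixture_density_def using lam by (intro sum_ennreal) auto
  finally show ?thesis .
qed

text \<open>Functions of disjoint blocks of indices are independent. The block {1, 2} gives
  independence of the symbol from the total disturbance, which pairwise independence would
  not.\<close>

lemma (in prob_space) indep_vars_tripleD:
  fixes S N W :: "'a \<Rightarrow> 'b::euclidean_space"
  assumes "indep_vars (\<lambda>_. borel) (\<lambda>i. [S, N, W] ! i) {0, 1, 2}"
  shows "indep_var borel S borel N" "indep_var borel N borel W"
    "indep_var borel S borel (\<lambda>\<omega>. N \<omega> + W \<omega>)"
proof -
  note restrict = indep_var_restrict[OF assms]
  have "indep_var borel ((\<lambda>f. f 0) \<circ> (\<lambda>\<omega>. \<lambda>i\<in>{0}. ([S, N, W] ! i) \<omega>))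
      borel ((\<lambda>f. f 1) \<circ> (\<lambda>\<omega>. \<lambda>i\<in>{1}. ([S, N, W] ! i) \<omega>))"
    by (rule indep_var_compose[OF restrict]) auto
  then show "indep_var borel S borel N" by (simp add: comp_def)
  have "indep_var borel ((\<lambda>f. f 1) \<circ> (\<lambda>\<omega>. \<lambda>i\<in>{1}. ([S, N, W] ! i) \<omega>))
      borel ((\<lambda>f. f 2) \<circ> (\<lambda>\<omega>. \<lambda>i\<in>{2}. ([S, N, W] ! i) \<omega>))"
    by (rule indep_var_compose[OF restrict]) auto
  then show "indep_var borel N borel W" by (simp add: comp_def)
  have "indep_var borel ((\<lambda>f. f 0) \<circ> (\<lambda>\<omega>. \<lambda>i\<in>{0}. ([S, N, W] ! i) \<omega>))
      borel ((\<lambda>f. f 1 + f 2) \<circ> (\<lambda>\<omega>. \<lambda>i\<in>{1, 2}. ([S, N, W] ! i) \<omega>))"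
    by (rule indep_var_compose[OF restrict]) auto
  then show "indep_var borel S borel (\<lambda>\<omega>. N \<omega> + W \<omega>)" by (simp add: comp_def)
qed

text \<open>One side has at least two levels, so the squares sum to more than 2; for a single point
  the denominator in \<open>d_min\<close> would be 0.\<close>

lemma d_min_pos:
  assumes "1 \<le> m" "1 \<le> m'" "2 \<le> m * m'" "0 < P"
  shows "0 < d_min m m' P"
proof -
  have "2 < m\<^sup>2 + m'\<^sup>2"
  proof (cases "m = 1")
    case True
    then have "2 * 2 \<le> m' * m'" using assms by (intro mult_mono) auto
    then show ?thesis using True by (simp add: power2_eq_square)
  next
    case False
    then have "2 * 2 \<le> m * m" using assms by (intro mult_mono) auto
    then show ?thesis by (simp add: power2_eq_square)
  qed
  then have "2 < (real m)\<^sup>2 + (real m')\<^sup>2"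
    by (metis of_nat_add of_nat_less_iff of_nat_numeral of_nat_power)
  then show ?thesis
    using assms(4) by (simp add: d_min_def)
qed

context sss_system
begin

abbreviation decision_state :: "nat \<Rightarrow> nat \<Rightarrow> 'a set" where
  "decision_state k j \<equiv> {\<omega> \<in> space M. D \<omega> = k \<and> H \<omega> = j}"

(* Total disturbance under state j, whose law is the Gaussian mixture given by the next three
   parameters; the pure noise is a mixture with a single component. *)
definition disturbance :: "nat \<Rightarrow> 'a \<Rightarrow> complex" where
  "disturbance j \<omega> = N \<omega> + (if j = 1 then W \<omega> else 0)"

definition components :: "nat \<Rightarrow> nat" where
  "components j = (if j = 1 then p else 1)"

definition weight :: "nat \<Rightarrow> nat \<Rightarrow> real" where
  "weight j = (if j = 1 then lam else (\<lambda>_. 1))"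

definition deviation :: "nat \<Rightarrow> nat \<Rightarrow> real" where
  "deviation j = (if j = 1 then (\<lambda>l. sqrt ((\<sigma> l)\<^sup>2 + \<sigma>\<^sub>n\<^sup>2)) else (\<lambda>_. \<sigma>\<^sub>n))"

abbreviation disturbance_density :: "nat \<Rightarrow> complex \<Rightarrow> real" where
  "disturbance_density j \<equiv> mixture_density (components j) (weight j) (deviation j)"

lemma deviation_nonzero: "l \<in> {1..components j} \<Longrightarrow> deviation j l \<noteq> 0"
  using noise_variance mixture_variance[of l]
  by (auto simp: components_def deviation_def add_nonneg_eq_0_iff)

lemma weight_nonneg: "l \<in> {1..components j} \<Longrightarrow> 0 \<le> weight j l"
  using mixture_weights(1)[of l] by (auto simp: components_def weight_def)

lemma sum_weight: "(\<Sum>l=1..components j. weight j l) = 1"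
  using mixture_weights(2) by (simp add: components_def weight_def)

lemma disturbance_density_strict_antimono:
  "cmod z < cmod w \<Longrightarrow> disturbance_density j w < disturbance_density j z"
  by (rule mixture_density_strict_antimono[OF deviation_nonzero weight_nonneg sum_weight])

lemma received_eq:
  "\<omega> \<in> decision_state k j \<Longrightarrow> received H S N W h \<omega> = h * S \<omega> + disturbance j \<omega>"
  by (auto simp: received_def disturbance_def)

lemma sets_decision_state [measurable]: "decision_state k j \<in> sets M"
  by measurable

lemma borel_measurable_disturbance [measurable]: "disturbance j \<in> borel_measurable M"
  unfolding disturbance_def by measurable

section \<open>Laws given a decision and a state of positive joint probability\<close>

context
  fixes k j :: nat
  assumes k: "k \<in> {0, 1}" and j: "j \<in> {0, 1}" and pos: "0 < prob (decision_state k j)"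
begin

lemma prob_space_decision_state: "prob_space (uniform_measure M (decision_state k j))"
  using pos by (intro prob_space_uniform_measure) (auto simp: emeasure_eq_measure)

interpretation cond: prob_space "uniform_measure M (decision_state k j)"
  by (rule prob_space_decision_state)

lemma indep_symbol_disturbance: "cond.indep_var borel S borel (disturbance j)"
  using cond.indep_vars_tripleD[OF symbol_noise_interference_indep[OF k j pos]] j
  by (auto simp: disturbance_def[abs_def])

lemma distributed_disturbance:
  "distributed (uniform_measure M (decision_state k j)) lborel (disturbance j)
    (\<lambda>z. ennreal (disturbance_density j z))"
proof (cases "j = 1")
  case True
  have "distributed (uniform_measure M (decision_state k j)) lborel (\<lambda>\<omega>. N \<omega> + W \<omega>)
      (\<lambda>z. \<integral>\<^sup>+w. ennreal (gauss_density \<sigma>\<^sub>n (z - w)) * ennreal (mixture_density p lam \<sigma> w) \<partial>lborel)"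
    by (intro cond.distributed_convolution_euclidean noise_density[OF k j pos]
        interference_density[OF k j pos]
        cond.indep_vars_tripleD(2)[OF symbol_noise_interference_indep[OF k j pos]])
  also have "(\<lambda>z. \<integral>\<^sup>+w. ennreal (gauss_density \<sigma>\<^sub>n (z - w)) * ennreal (mixture_density p lam \<sigma> w) \<partial>lborel)
      = (\<lambda>z. ennreal (mixture_density p lam (\<lambda>l. sqrt ((\<sigma> l)\<^sup>2 + \<sigma>\<^sub>n\<^sup>2)) z))"
    using noise_variance mixture_variance mixture_weights(1)
    by (intro ext conv_gauss_mixture_density) auto
  finally show ?thesis
    using True by (simp add: disturbance_def[abs_def] components_def weight_def deviation_def)
next
  case False
  then show ?thesis
    using noise_density[OF k j pos]
    by (simp add: disturbance_def[abs_def] components_def weight_def deviation_def mixture_density_def)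
qed

lemma symbol_prob:
  assumes "s \<in> qam_points M_I M_Q (P k)"
  shows "cond.prob {\<omega> \<in> space M. S \<omega> = s} = 1 / (real M_I * real M_Q)"
  using symbol_uniform[OF k j pos assms]
    measure_uniform_measure_eq_cond_prob[of "\<lambda>\<omega>. S \<omega> = s" "\<lambda>\<omega>. D \<omega> = k \<and> H \<omega> = j"]
  by simp

text \<open>Given the symbol, the received signal is a translate of the disturbance, whose law is
  unaffected by independence. The translated density is thus another version of the given one, and
  densities are unique almost everywhere.\<close>

lemma AE_conditional_density:
  assumes dens: "is_conditional_density M M_I M_Q P H D S (received H S N W) f"
    and s: "s \<in> qam_points M_I M_Q (P k)"
  shows "AE y in lborel. f h k j s y = disturbance_density j (y - h * s)"
proof -
  let ?E = "decision_state k j"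
  let ?Es = "{\<omega> \<in> space M. D \<omega> = k \<and> H \<omega> = j \<and> S \<omega> = s}"
  let ?U = "uniform_measure M ?Es"
  have sp: "0 < cond.prob {\<omega> \<in> space M. S \<omega> = s}"
    using symbol_prob[OF s] qam_size by simp
  have E0: "emeasure M ?E \<noteq> 0" "emeasure M ?E \<noteq> \<infinity>"
    using pos by (auto simp: emeasure_eq_measure)
  \<comment> \<open>Conditioning proceeds in two stages, first on decision and state and then on the
    symbol, because independence is available only after the first.\<close>
  have prob_cond: "prob (?E \<inter> B) = prob ?E * cond.prob B" if "B \<in> sets M" for B
    using pos measure_uniform_measure[OF E0 that] by simp
  have Es: "?Es = ?E \<inter> {\<omega> \<in> space M. S \<omega> = s}" by auto
  have Es_pos: "0 < prob ?Es"
    unfolding Es by (subst prob_cond) (use sp pos in auto)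
  then have Es0: "emeasure M ?Es \<noteq> 0" "emeasure M ?Es \<noteq> \<infinity>"
    by (auto simp: emeasure_eq_measure)
  interpret U: prob_space ?U
    using Es0 by (rule prob_space_uniform_measure)
  have [measurable]: "received H S N W h \<in> borel_measurable M"
    unfolding received_def by measurable
  have "distributed ?U lborel (received H S N W h) (\<lambda>y. ennreal (disturbance_density j (y - h * s)))"
    unfolding distributed_def
  proof (intro conjI measure_eqI)
    fix A assume "A \<in> sets (distr ?U lborel (received H S N W h))"
    then have A [measurable]: "A \<in> sets borel" by simp
    let ?A = "{v. h * s + v \<in> A}"
    have A' [measurable]: "?A \<in> sets borel" by measurable
    have "U.prob (received H S N W h -` A \<inter> space M)
        = prob (?Es \<inter> (received H S N W h -` A \<inter> space M)) / prob ?Es"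
      by (rule measure_uniform_measure[OF Es0]) measurable
    also have "?Es \<inter> (received H S N W h -` A \<inter> space M)
        = ?E \<inter> ((\<lambda>\<omega>. (S \<omega>, disturbance j \<omega>)) -` ({s} \<times> ?A) \<inter> space M)"
      using received_eq[of _ k j h] by auto
    also have "prob \<dots> = prob ?E * cond.prob ((\<lambda>\<omega>. (S \<omega>, disturbance j \<omega>)) -` ({s} \<times> ?A) \<inter> space M)"
      by (rule prob_cond) measurable
    also have "cond.prob ((\<lambda>\<omega>. (S \<omega>, disturbance j \<omega>)) -` ({s} \<times> ?A) \<inter> space M)
        = cond.prob (S -` {s} \<inter> space M) * cond.prob (disturbance j -` ?A \<inter> space M)"
      using cond.indep_varD[OF indep_symbol_disturbance, of "{s}" ?A] by simp
    also have "S -` {s} \<inter> space M = {\<omega> \<in> space M. S \<omega> = s}" by auto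
    also have "prob ?Es = prob ?E * cond.prob {\<omega> \<in> space M. S \<omega> = s}"
      unfolding Es by (rule prob_cond) measurable
    finally have "U.prob (received H S N W h -` A \<inter> space M) = cond.prob (disturbance j -` ?A \<inter> space M)"
      using sp pos by simp
    then have "emeasure (distr ?U lborel (received H S N W h)) A
        = emeasure (uniform_measure M ?E) (disturbance j -` ?A \<inter> space M)"
      by (simp add: emeasure_distr U.emeasure_eq_measure cond.emeasure_eq_measure)
    also have "\<dots> = (\<integral>\<^sup>+v. ennreal (disturbance_density j v) * indicator ?A v \<partial>lborel)"
      using distributed_emeasure[OF distributed_disturbance, of ?A] by simp
    also have "\<dots> = (\<integral>\<^sup>+y. ennreal (disturbance_density j (y - h * s)) * indicator A y \<partial>lborel)"
      using nn_integral_lborel_translate[of "\<lambda>y. ennreal (disturbance_density j (y - h * s)) * indicator A y" "h * s"]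
      by (simp add: indicator_def)
    also have "\<dots> = emeasure (density lborel (\<lambda>y. ennreal (disturbance_density j (y - h * s)))) A"
      by (simp add: emeasure_density)
    finally show "emeasure (distr ?U lborel (received H S N W h)) A
        = emeasure (density lborel (\<lambda>y. ennreal (disturbance_density j (y - h * s)))) A" .
  qed simp_all
  moreover have "distributed ?U lborel (received H S N W h) (\<lambda>y. ennreal (f h k j s y))"
    using dens k j s pos unfolding is_conditional_density_def by blast
  ultimately have "AE y in lborel. ennreal (disturbance_density j (y - h * s)) = ennreal (f h k j s y)"
    by (rule U.distributed_unique)
  then show ?thesis
  proof eventually_elim
    case (elim y)
    then show ?case
      using mixture_density_nonneg[of "components j" "weight j"] weight_nonneg dens
      by (simp add: is_conditional_density_def)
  qed
qed

end

end

section \<open>The maximum a posteriori detector\<close>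

context sss_system
begin

lemma prob_decision_state:
  assumes "k \<in> {0, 1}"
  shows "prob (decision_state k j) = \<P>(\<omega> in M. D \<omega> = k) * \<P>(\<omega> in M. H \<omega> = j \<bar> D \<omega> = k)"
  using decision_pos[OF assms] by (simp add: cond_prob_def conj_commute)

lemma prob_decision_split:
  assumes A [measurable]: "A \<in> sets M"
  shows "prob A = (\<Sum>k=0..1. \<Sum>j=0..1. prob (decision_state k j \<inter> A))"
proof -
  let ?B = "\<lambda>(k, j). decision_state k j \<inter> A"
  have "H \<omega> \<in> {0, 1}" "D \<omega> \<in> {0, 1}" if "\<omega> \<in> space M" for \<omega>
    using measurable_space[OF random_variables(1) that] measurable_space[OF random_variables(2) that]
    by auto
  then have "A = (\<Union>z\<in>{0..1} \<times> {0..1}. ?B z)"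
    using sets.sets_into_space[OF A] by fastforce
  then have "prob A = prob (\<Union>z\<in>{0..1} \<times> {0..1}. ?B z)" by simp
  also have "\<dots> = (\<Sum>z\<in>{0..1} \<times> {0..1}. prob (?B z))"
    by (rule finite_measure_finite_Union) (auto simp: disjoint_family_on_def)
  finally show ?thesis
    by (simp add: sum.cartesian_product')
qed

lemma sum_posterior:
  assumes k: "k \<in> {0, 1}"
  shows "\<P>(\<omega> in M. H \<omega> = 0 \<bar> D \<omega> = k) + \<P>(\<omega> in M. H \<omega> = 1 \<bar> D \<omega> = k) = 1"
proof -
  have "H \<omega> \<in> {0, 1}" if "\<omega> \<in> space M" for \<omega>
    using measurable_space[OF random_variables(1) that] by auto
  then have "{\<omega> \<in> space M. D \<omega> = k} = decision_state k 0 \<union> decision_state k 1"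
    by auto
  then have "prob {\<omega> \<in> space M. D \<omega> = k} = prob (decision_state k 0) + prob (decision_state k 1)"
    by (simp only:) (rule finite_measure_Union; auto)
  then have "prob {\<omega> \<in> space M. D \<omega> = k} * 1 = prob {\<omega> \<in> space M. D \<omega> = k} *
      (\<P>(\<omega> in M. H \<omega> = 0 \<bar> D \<omega> = k) + \<P>(\<omega> in M. H \<omega> = 1 \<bar> D \<omega> = k))"
    unfolding prob_decision_state[OF k] distrib_left by simp
  then show ?thesis
    using decision_pos[OF k] by simp
qed

(* Every component density decreases strictly in the distance to the faded symbol, so a maximizer
   of their mixture over the constellation is a nearest faded symbol. *)
lemma AE_map_detector_nearest:
  assumes dens: "is_conditional_density M M_I M_Q P H D S (received H S N W) f"
    and det: "is_map_detector M M_I M_Q P H D f detect" and k: "k \<in> {0, 1}"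
  shows "AE y in lborel. \<forall>s\<in>qam_points M_I M_Q (P k).
    cmod (y - h * detect k h y) \<le> cmod (y - h * s)"
proof -
  let ?C = "qam_points M_I M_Q (P k)"
  define w where "w j = \<P>(\<omega> in M. H \<omega> = j \<bar> D \<omega> = k)" for j
  have w_nonneg: "0 \<le> w j" for j
    by (simp add: w_def cond_prob_def)
  \<comment> \<open>The weight is kept as a factor: where decision and state have joint probability
    0 the density \<open>f\<close> is unconstrained, and there the weight is 0.\<close>
  have "AE y in lborel. w j * f h k j s y = w j * disturbance_density j (y - h * s)"
    if j: "j \<in> {0, 1}" and s: "s \<in> ?C" for j s
  proof (cases "w j = 0")
    case False
    then have "0 < prob (decision_state k j)"
      using decision_pos[OF k] w_nonneg[of j] unfolding prob_decision_state[OF k] w_def[symmetric]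
      by simp
    from AE_conditional_density[OF k j this dens s, of h] show ?thesis
      by eventually_elim simp
  qed simp
  \<comment> \<open>The constellation is finite, so one null set serves all symbols and both
    states.\<close>
  then have "AE y in lborel. \<forall>j\<in>{0, 1}. \<forall>s\<in>?C. w j * f h k j s y = w j * disturbance_density j (y - h * s)"
    by (intro AE_finite_allI) (auto simp: qam_points_eq)
  then show ?thesis
  proof eventually_elim
    case (elim y)
    have metric: "map_metric M H D f k h y s
        = w 0 * disturbance_density 0 (y - h * s) + w 1 * disturbance_density 1 (y - h * s)"
      if "s \<in> ?C" for s
    proof -
      have "w j * f h k j s y = w j * disturbance_density j (y - h * s)" if "j \<in> {0, 1}" for j
        using elim that \<open>s \<in> ?C\<close> by blast
      from this[of 0] this[of 1] show ?thesis
        unfolding map_metric_def w_def[symmetric] by auto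
    qed
    let ?t = "detect k h y"
    have t: "?t \<in> ?C" and max: "\<And>s. s \<in> ?C \<Longrightarrow> map_metric M H D f k h y s \<le> map_metric M H D f k h y ?t"
      using det k by (auto simp: is_map_detector_def)
    show ?case
    proof (intro ballI leI notI)
      fix s assume s: "s \<in> ?C" and less: "cmod (y - h * s) < cmod (y - h * ?t)"
      define \<delta> where "\<delta> j = disturbance_density j (y - h * s) - disturbance_density j (y - h * ?t)" for j
      have \<delta>: "0 < \<delta> j" for j
        using disturbance_density_strict_antimono[OF less] by (simp add: \<delta>_def)
      have "0 < w 0 \<or> 0 < w 1"
        using sum_posterior[OF k] w_nonneg[of 0] w_nonneg[of 1] unfolding w_def by linarith
      then have "0 < w 0 * \<delta> 0 + w 1 * \<delta> 1"
        using \<delta> w_nonneg by (auto intro: add_pos_nonneg add_nonneg_pos simp: less_imp_le)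
      then show False
        using max[OF s] unfolding metric[OF s] metric[OF t] \<delta>_def by (simp add: algebra_simps)
    qed
  qed
qed

lemma conditional_error_prob:
  fixes h :: complex
  assumes dens: "is_conditional_density M M_I M_Q P H D S (received H S N W) f"
    and det: "is_map_detector M M_I M_Q P H D f detect"
    and k: "k \<in> {0, 1}" and j: "j \<in> {0, 1}" and P: "0 < P k" and h: "h \<noteq> 0"
  defines "a \<equiv> \<lambda>l. sqrt ((d_min M_I M_Q (P k))\<^sup>2 * (cmod h)\<^sup>2 / (4 * (deviation j l)\<^sup>2))"
  shows "prob (decision_state k j \<inter> {\<omega> \<in> space M. detect (D \<omega>) h (received H S N W h \<omega>) \<noteq> S \<omega>})
    = prob (decision_state k j) *
      (2 * (2 - 1 / real M_I - 1 / real M_Q) * (\<Sum>l=1..components j. weight j l * Q_fun (a l))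
       - 4 * (1 - 1 / real M_I) * (1 - 1 / real M_Q) * (\<Sum>l=1..components j. weight j l * (Q_fun (a l))\<^sup>2))"
\<comment> \<open>The claim concerns joint probabilities, so an impossible pair gives 0 on both
  sides; otherwise one may condition on it.\<close>
proof (cases "prob (decision_state k j) = 0")
  case True
  then have "prob (decision_state k j \<inter> B) = 0" for B
    using finite_measure_mono[of "decision_state k j \<inter> B" "decision_state k j"]
      measure_nonneg[of M "decision_state k j \<inter> B"] by simp
  then show ?thesis using True by simp
next
  case False
  then have pos: "0 < prob (decision_state k j)"
    using measure_nonneg[of M "decision_state k j"] by linarith
  let ?\<mu> = "uniform_measure M (decision_state k j)"
  interpret cond: prob_space ?\<mu>
    using k j pos by (rule prob_space_decision_state)
  have pair: "(\<lambda>z. detect k (fst z) (snd z)) \<in> borel_measurable (borel \<Otimes>\<^sub>M borel)"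
    using det k by (auto simp: is_map_detector_def case_prod_beta)
  have [measurable]: "detect k h \<in> borel_measurable borel"
    using measurable_compose[OF _ pair, of "\<lambda>y. (h, y)" borel] by simp
  have [measurable]: "{\<omega> \<in> space M. detect k h (h * S \<omega> + disturbance j \<omega>) \<noteq> S \<omega>} \<in> sets M"
    by measurable
  have d: "0 < d_min M_I M_Q (P k)"
    using qam_size P by (rule d_min_pos)
  have "decision_state k j \<inter> {\<omega> \<in> space M. detect (D \<omega>) h (received H S N W h \<omega>) \<noteq> S \<omega>}
      = decision_state k j \<inter> {\<omega> \<in> space M. detect k h (h * S \<omega> + disturbance j \<omega>) \<noteq> S \<omega>}"
    using received_eq[of _ k j h] by auto
  also have "prob \<dots> = prob (decision_state k j) *
      measure ?\<mu> {\<omega> \<in> space M. detect k h (h * S \<omega> + disturbance j \<omega>) \<noteq> S \<omega>}"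
    using pos by (subst measure_uniform_measure) (auto simp: emeasure_eq_measure)
  also have "{\<omega> \<in> space M. detect k h (h * S \<omega> + disturbance j \<omega>) \<noteq> S \<omega>}
      = {\<omega> \<in> space ?\<mu>. detect k h (h * S \<omega> + disturbance j \<omega>) \<noteq> S \<omega>}"
    by simp
  also have "measure ?\<mu> \<dots>
      = 2 * (2 - 1 / real M_I - 1 / real M_Q) * (\<Sum>l=1..components j. weight j l * Q_fun (a l))
       - 4 * (1 - 1 / real M_I) * (1 - 1 / real M_Q) * (\<Sum>l=1..components j. weight j l * (Q_fun (a l))\<^sup>2)"
    unfolding a_def
  proof (rule cond.qam_error_probability[OF indep_symbol_disturbance[OF k j pos]
        distributed_disturbance[OF k j pos] _ deviation_nonzero weight_nonneg sum_weight h d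
        qam_size(1,2), folded qam_points_eq])
    show "measure ?\<mu> {\<omega> \<in> space ?\<mu>. S \<omega> = s} = 1 / (real M_I * real M_Q)"
      if "s \<in> qam_points M_I M_Q (P k)" for s
      using symbol_prob[OF k j pos that] by simp
    show "AE y in lborel. \<forall>s\<in>qam_points M_I M_Q (P k). cmod (y - h * detect k h y) \<le> cmod (y - h * s)"
      by (rule AE_map_detector_nearest[OF dens det k])
    show "detect k h y \<in> qam_points M_I M_Q (P k)" for y
      using det k by (auto simp: is_map_detector_def)
  qed auto
  finally show ?thesis .
qed

end

theorem mainTheorem2:
  fixes M :: "'a measure"
    and M_I M_Q :: nat
    and P :: "nat \<Rightarrow> real"
    and \<sigma>\<^sub>n :: real
    and p :: nat and lam :: "nat \<Rightarrow> real" and \<sigma> :: "nat \<Rightarrow> real"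
    and H D :: "'a \<Rightarrow> nat"
    and S N W G :: "'a \<Rightarrow> complex"
    and f :: "complex \<Rightarrow> nat \<Rightarrow> nat \<Rightarrow> complex \<Rightarrow> complex \<Rightarrow> real"
    and detect :: "nat \<Rightarrow> complex \<Rightarrow> complex \<Rightarrow> complex"
    and h :: complex
    and a0 :: "nat \<Rightarrow> real" and a1 :: "nat \<Rightarrow> nat \<Rightarrow> real"
  assumes system: "sss_system M M_I M_Q P \<sigma>\<^sub>n p lam \<sigma> H D S N W G"
    and power_pos: "0 < P 0" "0 < P 1"
    and density: "is_conditional_density M M_I M_Q P H D S (received H S N W) f"
    and detector: "is_map_detector M M_I M_Q P H D f detect"
    and h: "h \<noteq> 0"
    and a0: "\<And>k. a0 k = sqrt ((d_min M_I M_Q (P k))\<^sup>2 * (cmod h)\<^sup>2 / (4 * \<sigma>\<^sub>n\<^sup>2))"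
    and a1: "\<And>k l. a1 k l =
      sqrt ((d_min M_I M_Q (P k))\<^sup>2 * (cmod h)\<^sup>2 / (4 * ((\<sigma> l)\<^sup>2 + \<sigma>\<^sub>n\<^sup>2)))"
  shows "SEP M D S (received H S N W) detect h =
    (\<Sum>k = 0..1. \<P>(\<omega> in M. D \<omega> = k) *
      (\<P>(\<omega> in M. H \<omega> = 0 \<bar> D \<omega> = k) *
         (2 * (2 - 1 / real M_I - 1 / real M_Q) * Q_fun (a0 k)
          - 4 * (1 - 1 / real M_I) * (1 - 1 / real M_Q) * (Q_fun (a0 k))\<^sup>2)
       + \<P>(\<omega> in M. H \<omega> = 1 \<bar> D \<omega> = k) *
         (2 * (2 - 1 / real M_I - 1 / real M_Q) * (\<Sum>l = 1..p. lam l * Q_fun (a1 k l))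
          - 4 * (1 - 1 / real M_I) * (1 - 1 / real M_Q)
            * (\<Sum>l = 1..p. lam l * (Q_fun (a1 k l))\<^sup>2))))"
proof -
  interpret sss_system M M_I M_Q P \<sigma>\<^sub>n p lam \<sigma> H D S N W G by (rule system)
  let ?err = "{\<omega> \<in> space M. detect (D \<omega>) h (received H S N W h \<omega>) \<noteq> S \<omega>}"
  have pair: "(\<lambda>z. detect k (fst z) (snd z)) \<in> borel_measurable (borel \<Otimes>\<^sub>M borel)"
    if "k \<in> {0, 1}" for k
    using detector that by (auto simp: is_map_detector_def case_prod_beta)
  have [measurable]: "detect 0 h \<in> borel_measurable borel" "detect 1 h \<in> borel_measurable borel"
    using measurable_compose[OF _ pair, of "\<lambda>y. (h, y)" borel] by simp_all
  have [measurable]: "received H S N W h \<in> borel_measurable M"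
    unfolding received_def by measurable
  have "D \<omega> \<in> {0, 1}" if "\<omega> \<in> space M" for \<omega>
    using measurable_space[OF random_variables(2) that] by auto
  \<comment> \<open>The detector is known to be measurable only for each decision separately, so the
    error event is split by decision to see that it is measurable.\<close>
  then have "?err = {\<omega> \<in> space M. D \<omega> = 0 \<and> detect 0 h (received H S N W h \<omega>) \<noteq> S \<omega>}
      \<union> {\<omega> \<in> space M. D \<omega> = 1 \<and> detect 1 h (received H S N W h \<omega>) \<noteq> S \<omega>}"
    by fastforce
  also have "\<dots> \<in> sets M" by measurable
  finally have "prob ?err = (\<Sum>k=0..1. \<Sum>j=0..1. prob (decision_state k j \<inter> ?err))"
    by (rule prob_decision_split)
  also have "\<dots> = (\<Sum>k=0..1. \<Sum>j=0..1. \<P>(\<omega> in M. D \<omega> = k) * \<P>(\<omega> in M. H \<omega> = j \<bar> D \<omega> = k) *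
      (2 * (2 - 1 / real M_I - 1 / real M_Q) * (\<Sum>l=1..components j. weight j l *
         Q_fun (sqrt ((d_min M_I M_Q (P k))\<^sup>2 * (cmod h)\<^sup>2 / (4 * (deviation j l)\<^sup>2))))
       - 4 * (1 - 1 / real M_I) * (1 - 1 / real M_Q) * (\<Sum>l=1..components j. weight j l *
         (Q_fun (sqrt ((d_min M_I M_Q (P k))\<^sup>2 * (cmod h)\<^sup>2 / (4 * (deviation j l)\<^sup>2))))\<^sup>2)))"
  proof (intro sum.cong refl)
    fix k j :: nat assume "k \<in> {0..1}" "j \<in> {0..1}"
    then have kj: "k \<in> {0, 1}" "j \<in> {0, 1}" by auto
    moreover have "0 < P k" using kj power_pos by auto
    ultimately show "prob (decision_state k j \<inter> ?err) = \<P>(\<omega> in M. D \<omega> = k) * \<P>(\<omega> in M. H \<omega> = j \<bar> D \<omega> = k) *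
      (2 * (2 - 1 / real M_I - 1 / real M_Q) * (\<Sum>l=1..components j. weight j l *
         Q_fun (sqrt ((d_min M_I M_Q (P k))\<^sup>2 * (cmod h)\<^sup>2 / (4 * (deviation j l)\<^sup>2))))
       - 4 * (1 - 1 / real M_I) * (1 - 1 / real M_Q) * (\<Sum>l=1..components j. weight j l *
         (Q_fun (sqrt ((d_min M_I M_Q (P k))\<^sup>2 * (cmod h)\<^sup>2 / (4 * (deviation j l)\<^sup>2))))\<^sup>2))"
      using conditional_error_prob[OF density detector kj _ h] prob_decision_state[OF kj(1), of j]
      by simp
  qed
  finally show ?thesis
    \<comment> \<open>In the idle state the mixture sums have a single term of weight 1, which gives
      the plain Q terms.\<close>
    unfolding SEP_def a0 a1
    by (simp add: components_def weight_def deviation_def distrib_left mult.assoc)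
qed

end
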